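(* Let $X$ be a Banach space. Then the set \[ \{ P \in \mathcal{P}_{wu}(^2 X) : AB(P) \in \mathrm{NRA}(^2 X^{**}) \} \] is (norm) dense in $\mathcal{P}_{wu}(^2 X)$.
   Context: Banach spaces are over $\mathbb{K}=\mathbb{R}$ or $\mathbb{C}$. For a Banach space $Y$, $S_Y$ is its unit sphere, $\Pi(Y) = \{(y,y^* ) \in S_Y \times S_{Y^*} : y^*(y)=1\}$, and $\mathcal{P}(^2 Y)$ is the Banach space of (continuous) $2$-homogeneous polynomials from $Y$ into $Y$ with norm $\|P\| = \sup_{\|y\| \leq 1} \|P(y)\|$. The numerical radius of $P \in \mathcal{P}(^2 Y)$ is $\nu(P) = \sup\{|y^*(P(y))| : (y,y^* ) \in \Pi(Y)\}$; $P$ attains its numerical radius if $\nu(P) = |y^*(P(y))|$ for some $(y,y^* )\in\Pi(Y)$; $\mathrm{NRA}(^2 Y)$ is the set of all such $P$. (Thus $\mathrm{NRA}(^2 X^{**})$ is formed using $\Pi(X^{**}) \subseteq S_{X^{**}} \times S_{X^{***}}$.) $\mathcal{P}_{wu}(^2 X)$ is the subspace of those $P \in \mathcal{P}(^2 X)$ that are weakly uniformly continuous on bounded subsets of $X$: for every bounded $A \subseteq X$ and $\varepsilon>0$ there are $\varphi_1,\ldots,\varphi_m \in X^*$ and $\eta>0$ such that $\|P(x)-P(y)\| < \varepsilon$ whenever $x,y \in A$ and $|\varphi_i(x-y)|<\eta$ for $i=1,\ldots,m$. Given a bounded bilinear mapping $B : X \times X \to X$, its canonical (Arens) extension $\overline{B}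 : X^{**} \times X^{**} \to X^{**}$ is defined by $\overline{B}(x^{**},y^{**}) = \lim_\alpha \lim_\beta B(x_\alpha,y_\beta)$ (iterated weak-star limits), where $(x_\alpha),(y_\beta)\subseteq X$ are nets converging weak-star to $x^{**}$ and $y^{**}$ respectively. The Aron-Berner extension of $P \in \mathcal{P}(^2 X)$ is $AB(P) \in \mathcal{P}(^2 X^{**})$ given by $AB(P)(x^{**}) = \overline{B}(x^{**},x^{**})$, where $B$ is the unique symmetric bilinear mapping from $X \times X$ into $X$ with $P(x)=B(x,x)$. *)

theory Defs
  imports "HOL-Analysis.Analysis"
begin

section \<open>Complex Banach spaces\<close>

text \<open>
  HOL-Analysis has real normed spaces only.  A complex normed space is a real one
  together with a compatible multiplication by complex scalars.
\<close>

class complex_normed_vector = real_normed_vector +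
  fixes scaleC :: "complex \<Rightarrow> 'a \<Rightarrow> 'a" (infixr \<open>*\<^sub>C\<close> 75)
  assumes scaleC_add_right: "c *\<^sub>C (x + y) = c *\<^sub>C x + c *\<^sub>C y"
    and scaleC_add_left: "(c + d) *\<^sub>C x = c *\<^sub>C x + d *\<^sub>C x"
    and scaleC_scaleC: "c *\<^sub>C d *\<^sub>C x = (c * d) *\<^sub>C x"
    and scaleC_of_real: "complex_of_real r *\<^sub>C x = r *\<^sub>R x"
    and norm_scaleC: "norm (c *\<^sub>C x) = cmod c * norm x"

class complex_banach = complex_normed_vector + banach

instantiation complex :: complex_banach
begin
definition scaleC_complex :: "complex \<Rightarrow> complex \<Rightarrow> complex" where
  "scaleC_complex c x = c * x"
instance
  by standard (auto simp: scaleC_complex_def algebra_simps norm_mult scaleR_conv_of_real)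
end


section \<open>Functionals, polynomials and numerical radius\<close>

text \<open>
  To treat the scalar fields \<open>\<real>\<close> and \<open>\<complex>\<close> alike, the notions below take the scalar
  multiplication \<open>sc\<close> as a parameter: it is \<^const>\<open>scaleR\<close> for real spaces and
  \<^const>\<open>scaleC\<close> for complex ones.  Additivity, real homogeneity and boundedness come from
  the library predicates \<^const>\<open>bounded_linear\<close> and \<^const>\<open>bounded_bilinear\<close>.
\<close>

definition functionals ::
  "('k::real_normed_field \<Rightarrow> 'y::real_normed_vector \<Rightarrow> 'y) \<Rightarrow> ('y \<Rightarrow> 'k) set" where
  "functionals sc = {f. bounded_linear f \<and> (\<forall>c y. f (sc c y) = c * f y)}"

definition bilinear_maps ::
  "('k::real_normed_field \<Rightarrow> 'y::real_normed_vector \<Rightarrow> 'y) \<Rightarrow> ('y \<Rightarrow> 'y \<Rightarrow> 'y) set" where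
  "bilinear_maps sc = {B. bounded_bilinear B \<and>
     (\<forall>c x y. B (sc c x) y = sc c (B x y) \<and> B x (sc c y) = sc c (B x y))}"

definition poly2 ::
  "('k::real_normed_field \<Rightarrow> 'y::real_normed_vector \<Rightarrow> 'y) \<Rightarrow> ('y \<Rightarrow> 'y) set" where
  "poly2 sc = {P. \<exists>B \<in> bilinear_maps sc. \<forall>x. P x = B x x}"

definition poly_norm :: "('y::real_normed_vector \<Rightarrow> 'y) \<Rightarrow> real" where
  "poly_norm P = (SUP y \<in> {y. norm y \<le> 1}. norm (P y))"

definition poly_dense ::
  "('y::real_normed_vector \<Rightarrow> 'y) set \<Rightarrow> ('y \<Rightarrow> 'y) set \<Rightarrow> bool" where
  "poly_dense S T \<longleftrightarrow> S \<subseteq> T \<and>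
     (\<forall>P \<in> T. \<forall>\<epsilon> > 0. \<exists>Q \<in> S. poly_norm (\<lambda>x. P x - Q x) < \<epsilon>)"

definition polar_pairs ::
  "('k::real_normed_field \<Rightarrow> 'y::real_normed_vector \<Rightarrow> 'y) \<Rightarrow> ('y \<times> ('y \<Rightarrow> 'k)) set" where
  "polar_pairs sc = {(y, f). norm y = 1 \<and> f \<in> functionals sc \<and> onorm f = 1 \<and> f y = 1}"

definition num_radius ::
  "('k::real_normed_field \<Rightarrow> 'y::real_normed_vector \<Rightarrow> 'y) \<Rightarrow> ('y \<Rightarrow> 'y) \<Rightarrow> real" where
  "num_radius sc P = (SUP (y, f) \<in> polar_pairs sc. norm (f (P y)))"

text \<open>
  On the zero space \<^const>\<open>polar_pairs\<close> is empty: \<^const>\<open>num_radius\<close> is then unspecified and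
  no polynomial attains it.
\<close>

definition NRA2 ::
  "('k::real_normed_field \<Rightarrow> 'y::real_normed_vector \<Rightarrow> 'y) \<Rightarrow> ('y \<Rightarrow> 'y) set" where
  "NRA2 sc = {P \<in> poly2 sc. \<exists>(y, f) \<in> polar_pairs sc. num_radius sc P = norm (f (P y))}"

definition poly2_wu ::
  "('k::real_normed_field \<Rightarrow> 'y::real_normed_vector \<Rightarrow> 'y) \<Rightarrow> ('y \<Rightarrow> 'y) set" where
  "poly2_wu sc = {P \<in> poly2 sc. \<forall>A \<epsilon>. bounded A \<and> \<epsilon> > 0 \<longrightarrow>
     (\<exists>\<Phi> \<eta>. finite \<Phi> \<and> \<Phi> \<subseteq> functionals sc \<and> \<eta> > 0 \<and>
       (\<forall>x \<in> A. \<forall>y \<in> A. (\<forall>\<phi> \<in> \<Phi>. norm (\<phi> (x - y)) < \<eta>) \<longrightarrow> norm (P x - P y) < \<epsilon>))}"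


section \<open>The Arens and Aron-Berner extensions\<close>

text \<open>
  In this section \<open>'a\<close>, \<open>'d\<close>, \<open>'e\<close> stand for \<open>X\<close>, \<open>X\<^sup>*\<close>, \<open>X\<^sup>*\<^sup>*\<close>; \<open>ev\<close> is the evaluation of an
  element of \<open>X\<^sup>*\<^sup>*\<close> at an element of \<open>X\<^sup>*\<close>, and \<open>J\<close> is the canonical embedding of \<open>X\<close> into
  \<open>X\<^sup>*\<^sup>*\<close>.  They are instantiated below with the actual dual spaces.
\<close>

definition weak_star :: "('e \<Rightarrow> 'd \<Rightarrow> 'k::topological_space) \<Rightarrow> 'e topology" where
  "weak_star ev = pullback_topology UNIV ev (product_topology (\<lambda>_. euclidean) UNIV)"

text \<open>
  Nets in \<open>X\<close> are represented by proper filters on \<open>X\<close>: \<open>F\<close> is the filter of \<open>(x\<^sub>\<alpha>)\<close>, \<open>G\<close> that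
  of \<open>(y\<^sub>\<beta>)\<close>, and \<open>h x\<close> is the inner limit \<open>lim\<^sub>\<beta> B (x, y\<^sub>\<beta>)\<close>.  The value does not depend on the
  nets chosen, and weak-star convergent nets exist for all \<open>u\<close>, \<open>v\<close>, so \<open>w\<close> is determined.
\<close>

definition arens ::
  "('e \<Rightarrow> 'd \<Rightarrow> 'k::topological_space) \<Rightarrow> ('a \<Rightarrow> 'e) \<Rightarrow> ('a \<Rightarrow> 'a \<Rightarrow> 'a) \<Rightarrow> 'e \<Rightarrow> 'e \<Rightarrow> 'e" where
  "arens ev J B u v = (THE w. \<forall>F G. F \<noteq> bot \<and> G \<noteq> bot \<and>
     limitin (weak_star ev) J u F \<and> limitin (weak_star ev) J v G \<longrightarrow>
     (\<exists>h. (\<forall>x. limitin (weak_star ev) (\<lambda>y. J (B x y)) (h x) G) \<and>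
          limitin (weak_star ev) h w F))"

definition symmetric_bilinear ::
  "('k::real_normed_field \<Rightarrow> 'y::real_normed_vector \<Rightarrow> 'y) \<Rightarrow> ('y \<Rightarrow> 'y) \<Rightarrow> 'y \<Rightarrow> 'y \<Rightarrow> 'y" where
  "symmetric_bilinear sc P = (THE B. B \<in> bilinear_maps sc \<and>
     (\<forall>x y. B x y = B y x) \<and> (\<forall>x. P x = B x x))"

definition aron_berner ::
  "('k::real_normed_field \<Rightarrow> 'a::real_normed_vector \<Rightarrow> 'a) \<Rightarrow> ('e \<Rightarrow> 'd \<Rightarrow> 'k) \<Rightarrow> ('a \<Rightarrow> 'e) \<Rightarrow>
   ('a \<Rightarrow> 'a) \<Rightarrow> 'e \<Rightarrow> 'e" where
  "aron_berner sc ev J P u = arens ev J (symmetric_bilinear sc P) u u"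


section \<open>Real duals\<close>

type_synonym 'a rdual = "'a \<Rightarrow>\<^sub>L real"

definition AB_real ::
  "('a::real_normed_vector \<Rightarrow> 'a) \<Rightarrow> 'a rdual rdual \<Rightarrow> 'a rdual rdual" where
  "AB_real = aron_berner (*\<^sub>R) blinfun_apply blinfun.prod_left"

lemma rdual_embedding_apply: "blinfun_apply (blinfun.prod_left x) \<phi> = blinfun_apply \<phi> x"
  by simp


section \<open>Complex duals\<close>

typedef (overloaded) 'a cdual =
  "functionals (scaleC :: complex \<Rightarrow> 'a::complex_normed_vector \<Rightarrow> 'a)"
  morphisms cdual_apply Cdual
  by (rule exI[of _ "\<lambda>_. 0"]) (simp add: functionals_def)

setup_lifting type_definition_cdual

lemma onorm_mult_left:
  fixes f :: "'a::real_normed_vector \<Rightarrow> complex"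
  assumes "bounded_linear f"
  shows "onorm (\<lambda>x. c * f x) = cmod c * onorm f"
proof (cases "c = 0")
  case True
  then show ?thesis by (simp add: onorm_zero)
next
  case False
  have le: "onorm (\<lambda>x. d * g x) \<le> cmod d * onorm g"
    if g: "bounded_linear g" for d and g :: "'a \<Rightarrow> complex"
  proof (rule onorm_bound)
    show "0 \<le> cmod d * onorm g"
      by (simp add: onorm_pos_le[OF g])
    show "norm (d * g x) \<le> cmod d * onorm g * norm x" for x
      using onorm[OF g, of x] by (simp add: norm_mult mult.assoc mult_left_mono)
  qed
  have "onorm f = onorm (\<lambda>x. inverse c * (c * f x))"
    using False by (simp add: mult.assoc [symmetric])
  also have "\<dots> \<le> cmod (inverse c) * onorm (\<lambda>x. c * f x)"
    by (rule le) (rule bounded_linear_const_mult[OF assms])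
  finally have "cmod c * onorm f \<le> onorm (\<lambda>x. c * f x)"
    using False by (simp add: norm_divide field_simps)
  with le[OF assms, of c] show ?thesis by simp
qed

instantiation cdual :: (complex_normed_vector) complex_normed_vector
begin

lift_definition zero_cdual :: "'a cdual" is "\<lambda>_. 0"
  by (simp add: functionals_def)

lift_definition plus_cdual :: "'a cdual \<Rightarrow> 'a cdual \<Rightarrow> 'a cdual" is "\<lambda>f g x. f x + g x"
  by (simp add: functionals_def bounded_linear_add distrib_left)

lift_definition minus_cdual :: "'a cdual \<Rightarrow> 'a cdual \<Rightarrow> 'a cdual" is "\<lambda>f g x. f x - g x"
  by (simp add: functionals_def bounded_linear_sub right_diff_distrib)

lift_definition uminus_cdual :: "'a cdual \<Rightarrow> 'a cdual" is "\<lambda>f x. - f x"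
  by (simp add: functionals_def bounded_linear_minus)

lift_definition scaleR_cdual :: "real \<Rightarrow> 'a cdual \<Rightarrow> 'a cdual" is "\<lambda>r f x. r *\<^sub>R f x"
  by (simp add: functionals_def bounded_linear_const_scaleR)

lift_definition scaleC_cdual :: "complex \<Rightarrow> 'a cdual \<Rightarrow> 'a cdual" is "\<lambda>c f x. c * f x"
  by (simp add: functionals_def bounded_linear_const_mult)

lift_definition norm_cdual :: "'a cdual \<Rightarrow> real" is onorm .

definition dist_cdual :: "'a cdual \<Rightarrow> 'a cdual \<Rightarrow> real" where
  "dist_cdual f g = norm (f - g)"

definition sgn_cdual :: "'a cdual \<Rightarrow> 'a cdual" where
  "sgn_cdual f = scaleR (inverse (norm f)) f"

definition uniformity_cdual :: "('a cdual \<times> 'a cdual) filter" where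
  "uniformity_cdual = (INF e\<in>{0<..}. principal {(f, g). dist f g < e})"

definition open_cdual :: "'a cdual set \<Rightarrow> bool" where
  "open_cdual U = (\<forall>f\<in>U. \<forall>\<^sub>F (f', g) in uniformity. f' = f \<longrightarrow> g \<in> U)"

instance
proof
  fix f g h :: "'a cdual" and r s :: real and c d :: complex
  show "f + g + h = f + (g + h)" by transfer (simp add: add.assoc)
  show "f + g = g + f" by transfer (simp add: add.commute)
  show "0 + f = f" by transfer simp
  show "- f + f = 0" by transfer simp
  show "f - g = f + - g" by transfer simp
  show "r *\<^sub>R (f + g) = r *\<^sub>R f + r *\<^sub>R g" by transfer (simp add: scaleR_right_distrib)
  show "(r + s) *\<^sub>R f = r *\<^sub>R f + s *\<^sub>R f" by transfer (simp add: scaleR_left_distrib)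
  show "r *\<^sub>R s *\<^sub>R f = (r * s) *\<^sub>R f" by transfer simp
  show "1 *\<^sub>R f = f" by transfer simp
  show "dist f g = norm (f - g)" by (rule dist_cdual_def)
  show "sgn f = scaleR (inverse (norm f)) f" by (rule sgn_cdual_def)
  show "uniformity = (INF e\<in>{0<..}. principal {(f, g :: 'a cdual). dist f g < e})"
    by (rule uniformity_cdual_def)
  show "open U = (\<forall>f\<in>U. \<forall>\<^sub>F (f', g) in uniformity. f' = f \<longrightarrow> g \<in> U)" for U :: "'a cdual set"
    by (rule open_cdual_def)
  show "(norm f = 0) = (f = 0)"
    by transfer (auto simp: functionals_def onorm_eq_0)
  show "norm (f + g) \<le> norm f + norm g"
    by transfer (simp add: functionals_def onorm_triangle)
  show "norm (r *\<^sub>R f) = \<bar>r\<bar> * norm f"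
    by transfer (simp add: functionals_def onorm_scaleR)
  show "c *\<^sub>C (f + g) = c *\<^sub>C f + c *\<^sub>C g" by transfer (simp add: distrib_left)
  show "(c + d) *\<^sub>C f = c *\<^sub>C f + d *\<^sub>C f" by transfer (simp add: distrib_right)
  show "c *\<^sub>C d *\<^sub>C f = (c * d) *\<^sub>C f" by transfer (simp add: mult.assoc)
  show "complex_of_real r *\<^sub>C f = r *\<^sub>R f" by transfer (simp add: scaleR_conv_of_real)
  show "norm (c *\<^sub>C f) = cmod c * norm f"
    by transfer (simp add: functionals_def onorm_mult_left)
qed

end

lemma norm_cdual_apply: "cmod (cdual_apply f x) \<le> norm f * norm x"
  by transfer (auto simp: functionals_def onorm)

lift_definition cdual_embedding :: "'a::complex_normed_vector \<Rightarrow> 'a cdual cdual"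
  is "\<lambda>x \<phi>. cdual_apply \<phi> x"
proof -
  fix x :: 'a
  have "bounded_linear (\<lambda>\<phi>. cdual_apply \<phi> x)"
  proof (rule bounded_linear_intro)
    show "cdual_apply (\<phi> + \<psi>) x = cdual_apply \<phi> x + cdual_apply \<psi> x" for \<phi> \<psi>
      by transfer simp
    show "cdual_apply (r *\<^sub>R \<phi>) x = r *\<^sub>R cdual_apply \<phi> x" for r \<phi>
      by transfer simp
    show "norm (cdual_apply \<phi> x) \<le> norm \<phi> * norm x" for \<phi>
      by (rule norm_cdual_apply)
  qed
  moreover have "cdual_apply (c *\<^sub>C \<phi>) x = c * cdual_apply \<phi> x" for c \<phi>
    by transfer simp
  ultimately show "(\<lambda>\<phi>. cdual_apply \<phi> x) \<in> functionals (*\<^sub>C)"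
    by (simp add: functionals_def)
qed

definition AB_complex ::
  "('a::complex_normed_vector \<Rightarrow> 'a) \<Rightarrow> 'a cdual cdual \<Rightarrow> 'a cdual cdual" where
  "AB_complex = aron_berner (*\<^sub>C) cdual_apply cdual_embedding"

end

theory Submission
  imports Defs
begin

text \<open>
  The proof follows Lindenstrauss: perturb the given polynomial by a rapidly decreasing series of
  rank-one terms until near-maximizing pairs cannot drift apart, and find the maximum at a weak-star
  cluster point.

  Suppose \<open>(x\<^sub>n, f\<^sub>n)\<close> in \<open>\<Pi>(X)\<close> almost attains the numerical radius of \<open>P\<^sub>n\<close>.  Then
  \<open>P\<^sub>n + e\<^sub>n \<theta>\<^sub>n f\<^sub>n(\<cdot>)\<^sup>2 x\<^sub>n\<close>, with the phase \<open>\<theta>\<^sub>n\<close> chosen well, has a numerical radius larger by about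
  \<open>e\<^sub>n\<close>.  A later pair \<open>(x\<^sub>m, f\<^sub>m)\<close>, which almost attains the radius of a polynomial much closer to
  this one than \<open>e\<^sub>n\<close>, has to collect almost all of that gain, and this is possible only if
  \<open>|f\<^sub>n(x\<^sub>m)|\<close> is almost \<open>1\<close> (\<open>perturbed_limit\<close>).  Let \<open>Q\<close> be the limit of the \<open>P\<^sub>n\<close>, let \<open>u\<close> in the
  bidual be a weak-star cluster point of the \<open>x\<^sub>m\<close>, and let \<open>h\<close> in the third dual be one of the
  \<open>f\<^sub>n\<close>.  Letting first \<open>m\<close> and then \<open>n\<close> tend to infinity gives \<open>|h(u)| = 1\<close>, so \<open>(u, h)\<close> is, up to a
  phase, in \<open>\<Pi>\<close> of the bidual.  A weakly uniformly continuous polynomial turns the weak-star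
  convergence of the \<open>x\<^sub>m\<close> into norm convergence of \<open>Q(x\<^sub>m)\<close>, and the limit is the Aron-Berner
  extension at \<open>u\<close> (\<open>aron_berner_limit\<close>).  Hence \<open>|h(AB(Q)(u))|\<close> is the limit of
  \<open>|f\<^sub>m(Q(x\<^sub>m))|\<close>, which is \<open>\<nu>(Q)\<close> (\<open>aron_berner_attains\<close>).

  What remains is \<open>\<nu>(AB(Q)) \<le> \<nu>(Q)\<close> (\<open>aron_berner_numerical_range_le\<close>).  Pairs in \<open>\<Pi>\<close> of the bidual
  cannot be approximated directly by pairs in \<open>\<Pi>(X)\<close>, because a weak-star approximation does not
  keep the value \<open>1\<close> of the functional at the point.  The numerical radius can however be read off
  from norms, as in Lumer's formula: \<open>\<parallel>x + c Q(x)\<parallel> \<le> 1 + |c| \<nu>(Q) + O(|c|\<^sup>2)\<close> on the unit ball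
  (\<open>norm_perturbation_le_num_radius\<close>).  Such an upper bound for norms does survive weak-star limits,
  so it extends to the bidual, and there it gives the inequality.

  The real and the complex case are treated at once.  The Hahn-Banach theorem is obtained from
  minimal sublinear functionals, and Goldstine's theorem from a least-squares argument.
\<close>


section \<open>The Hahn-Banach theorem\<close>

definition sublinear :: "('v::real_vector \<Rightarrow> real) \<Rightarrow> bool" where
  "sublinear p \<longleftrightarrow> (\<forall>x y. p (x + y) \<le> p x + p y) \<and> (\<forall>r x. 0 \<le> r \<longrightarrow> p (r *\<^sub>R x) = r * p x)"

lemma sublinear_add: "sublinear p \<Longrightarrow> p (x + y) \<le> p x + p y"
  and sublinear_scale: "sublinear p \<Longrightarrow> 0 \<le> r \<Longrightarrow> p (r *\<^sub>R x) = r * p x"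
  by (simp_all add: sublinear_def)

lemma sublinear_zero: "sublinear p \<Longrightarrow> p 0 = 0"
  using sublinear_scale[of p 0 0] by simp

lemma sublinear_ge_minus: "sublinear p \<Longrightarrow> - p (- x) \<le> p x"
  using sublinear_add[of p x "- x"] sublinear_zero[of p] by simp

text \<open>
  The hypotheses ask for a single index that does at least as well as the given ones.  Chains
  satisfy them, and so do families in which the indices can be added and scaled along with the
  points; both kinds of infimum are needed below.
\<close>

lemma sublinear_INF:
  fixes F :: "'i \<Rightarrow> 'v::real_vector \<Rightarrow> real"
  assumes ne: "I \<noteq> {}"
    and bdd: "\<And>x. bdd_below ((\<lambda>i. F i x) ` I)"
    and zero: "\<And>i. i \<in> I \<Longrightarrow> F i 0 = 0"
    and add: "\<And>i j x y. i \<in> I \<Longrightarrow> j \<in> I \<Longrightarrow> \<exists>k\<in>I. F k (x + y) \<le> F i x + F j y"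
    and scale: "\<And>i r x. i \<in> I \<Longrightarrow> 0 < r \<Longrightarrow> \<exists>k\<in>I. F k (r *\<^sub>R x) \<le> r * F i x"
  shows "sublinear (\<lambda>x. INF i\<in>I. F i x)"
proof -
  define u where "u x = (INF i\<in>I. F i x)" for x
  have low: "u x \<le> F i x" if "i \<in> I" for i x
    unfolding u_def by (rule cINF_lower[OF bdd that])
  have great: "m \<le> u x" if "\<And>i. i \<in> I \<Longrightarrow> m \<le> F i x" for m x
    unfolding u_def by (rule cINF_greatest[OF ne that])
  have "u (x + y) \<le> u x + u y" for x y
  proof -
    have "u (x + y) - F i x \<le> u y" if i: "i \<in> I" for i
    proof (rule great)
      fix j assume "j \<in> I"
      with add[OF i this, of x y] low[of _ "x + y"] show "u (x + y) - F i x \<le> F j y"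
        by fastforce
    qed
    then have "u (x + y) - u y \<le> u x"
      by (intro great) (simp add: algebra_simps)
    then show ?thesis by simp
  qed
  moreover have "u (r *\<^sub>R x) = r * u x" if "0 \<le> r" for r x
  proof (cases "r = 0")
    case True
    have "u 0 = 0"
    proof (rule antisym)
      obtain i where "i \<in> I" using ne by blast
      then show "u 0 \<le> 0" using low[of i 0] zero by simp
      show "0 \<le> u 0" by (rule great) (simp add: zero)
    qed
    with True show ?thesis by simp
  next
    case False
    have le: "u (s *\<^sub>R y) \<le> s * u y" if s: "0 < s" for s y
    proof -
      have "u (s *\<^sub>R y) / s \<le> u y"
      proof (rule great)
        fix i assume "i \<in> I"
        then obtain k where "k \<in> I" "F k (s *\<^sub>R y) \<le> s * F i y" using scale s by blast
        with low[of k "s *\<^sub>R y"] have "u (s *\<^sub>R y) \<le> s * F i y" by simp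
        then show "u (s *\<^sub>R y) / s \<le> F i y" using s by (simp add: field_simps)
      qed
      then show ?thesis using s by (simp add: field_simps)
    qed
    have r: "0 < r" using False that by simp
    have "u x \<le> inverse r * u (r *\<^sub>R x)"
      using le[of "inverse r" "r *\<^sub>R x"] r by simp
    then have "r * u x \<le> u (r *\<^sub>R x)" using r by (simp add: field_simps)
    with le[OF r, of x] show ?thesis by simp
  qed
  ultimately show ?thesis unfolding sublinear_def u_def by blast
qed

text \<open>
  By Zorn's lemma: the pointwise infimum of a chain below \<open>p\<close> is finite, since every
  sublinear \<open>q \<le> p\<close> satisfies \<open>q x \<ge> - q (- x) \<ge> - p (- x)\<close>.
\<close>

lemma minimal_sublinear_exists:
  fixes p :: "'v::real_vector \<Rightarrow> real"
  assumes p: "sublinear p"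
  obtains q where "sublinear q" "q \<le> p" "\<forall>q'. sublinear q' \<longrightarrow> q' \<le> q \<longrightarrow> q' = q"
proof -
  define A where "A = {q. sublinear q \<and> q \<le> p}"
  have "\<exists>m\<in>A. \<forall>a\<in>A. a \<le> m \<longrightarrow> a = m"
  proof (rule predicate_Zorn)
    show "partial_order_on A (relation_of (\<lambda>a u. u \<le> a) A)"
      by (rule partial_order_on_relation_ofI) auto
    fix C assume "C \<in> Chains (relation_of (\<lambda>a u. u \<le> a) A)"
    then have CA: "C \<subseteq> A" and chain: "\<And>a b. a \<in> C \<Longrightarrow> b \<in> C \<Longrightarrow> a \<le> b \<or> b \<le> a"
      by (auto simp: Chains_def relation_of_def)
    show "\<exists>u\<in>A. \<forall>a\<in>C. u \<le> a"
    proof (cases "C = {}")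
      case True
      then show ?thesis using p by (auto simp: A_def)
    next
      case False
      have subl: "sublinear q" and le_p: "q x \<le> p x" if "q \<in> C" for q x
        using that CA by (auto simp: A_def le_fun_def)
      have bdd: "bdd_below ((\<lambda>q. q x) ` C)" for x
      proof (rule bdd_belowI2)
        show "- p (- x) \<le> q x" if "q \<in> C" for q
          using sublinear_ge_minus[OF subl[OF that], of x] le_p[OF that, of "- x"] by simp
      qed
      define u where "u = (\<lambda>x. INF q\<in>C. q x)"
      have "sublinear u" unfolding u_def
      proof (rule sublinear_INF[OF False bdd])
        show "q 0 = 0" if "q \<in> C" for q using subl[OF that] by (rule sublinear_zero)
        show "\<exists>k\<in>C. k (x + y) \<le> a x + b y" if ab: "a \<in> C" "b \<in> C" for a b x y
        proof (cases "a \<le> b")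
          case True
          have "a (x + y) \<le> a x + a y" by (rule sublinear_add[OF subl[OF ab(1)]])
          also have "\<dots> \<le> a x + b y" using True by (simp add: le_fun_def)
          finally show ?thesis using ab by blast
        next
          case f: False
          have "b (x + y) \<le> b x + b y" by (rule sublinear_add[OF subl[OF ab(2)]])
          also have "\<dots> \<le> a x + b y"
          proof -
            have "b \<le> a" using f chain[OF ab] by blast
            then show ?thesis by (simp add: le_fun_def)
          qed
          finally show ?thesis using ab by blast
        qed
        show "\<exists>k\<in>C. k (r *\<^sub>R x) \<le> r * q x" if "q \<in> C" "0 < r" for q r x
          using that sublinear_scale[OF subl[OF that(1)], of r x] by (intro bexI[of _ q]) auto
      qed
      moreover have low: "u \<le> q" if "q \<in> C" for q
        unfolding u_def le_fun_def using cINF_lower[OF bdd that] by simp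
      moreover have "u \<le> p"
      proof -
        obtain q where "q \<in> C" using False by blast
        then have "q \<le> p" using CA by (auto simp: A_def)
        with low[OF \<open>q \<in> C\<close>] show ?thesis by (rule order_trans)
      qed
      ultimately show ?thesis unfolding A_def by blast
    qed
  qed
  then obtain m where "m \<in> A" and m: "\<And>a. a \<in> A \<Longrightarrow> a \<le> m \<Longrightarrow> a = m" by blast
  show thesis
  proof (rule that)
    show "sublinear m" "m \<le> p" using \<open>m \<in> A\<close> by (auto simp: A_def)
    show "\<forall>q'. sublinear q' \<longrightarrow> q' \<le> m \<longrightarrow> q' = m"
    proof (intro allI impI)
      fix q' assume q': "sublinear q'" "q' \<le> m"
      have "q' \<le> p" by (rule order_trans[OF q'(2) \<open>m \<le> p\<close>])
      with q' show "q' = m" by (intro m) (auto simp: A_def)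
    qed
  qed
qed

text \<open>
  The infimum over \<open>t \<ge> 0\<close> of \<open>q (x + t y) - t q y\<close> is the largest sublinear functional below \<open>q\<close>
  whose value at \<open>- y\<close> is \<open>- q y\<close>.  It serves twice: it shows that a minimal functional is odd, and it
  prepares the norm for a functional that norms a given vector.
\<close>

lemma sublinear_below_along:
  assumes q: "sublinear q"
  obtains q' where "sublinear q'" "q' \<le> q" "q' (- y) \<le> - q y"
proof -
  define F where "F t x = q (x + t *\<^sub>R y) - t * q y" for t x
  define u where "u x = (INF t\<in>{0..}. F t x)" for x
  have bdd: "bdd_below ((\<lambda>t. F t x) ` {0..})" for x
  proof (rule bdd_belowI2)
    fix t :: real assume "t \<in> {0..}"
    then show "- q (- x) \<le> F t x"
      using sublinear_add[OF q, of "x + t *\<^sub>R y" "- x"] sublinear_scale[OF q, of t y]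
      by (simp add: F_def)
  qed
  have low: "u x \<le> F t x" if "0 \<le> t" for t x
    unfolding u_def by (rule cINF_lower[OF bdd]) (use that in simp)
  show thesis
  proof (rule that)
    show "sublinear u" unfolding u_def
    proof (rule sublinear_INF[OF _ bdd])
      show "F t 0 = 0" if "t \<in> {0..}" for t
        using that sublinear_scale[OF q, of t y] by (simp add: F_def)
      show "\<exists>k\<in>{0..}. F k (x + x') \<le> F s x + F t x'" if st: "s \<in> {0..}" "t \<in> {0..}" for s t x x'
      proof (rule bexI[of _ "s + t"])
        have "q ((x + s *\<^sub>R y) + (x' + t *\<^sub>R y)) \<le> q (x + s *\<^sub>R y) + q (x' + t *\<^sub>R y)"
          by (rule sublinear_add[OF q])
        then show "F (s + t) (x + x') \<le> F s x + F t x'"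
          by (simp add: F_def algebra_simps)
      qed (use st in auto)
      show "\<exists>k\<in>{0..}. F k (r *\<^sub>R x) \<le> r * F t x" if t: "t \<in> {0..}" "0 < r" for r t x
      proof (rule bexI[of _ "r * t"])
        show "F (r * t) (r *\<^sub>R x) \<le> r * F t x"
          using sublinear_scale[OF q, of r "x + t *\<^sub>R y"] t by (simp add: F_def algebra_simps)
      qed (use t in auto)
    qed auto
    show "u \<le> q" using low[of 0] by (simp add: F_def le_fun_def)
    show "u (- y) \<le> - q y" using low[of 1 "- y"] sublinear_zero[OF q] by (simp add: F_def)
  qed
qed

text \<open>
  A minimal sublinear functional is odd, for otherwise it could be lowered along some direction, and
  an odd sublinear functional is linear.
\<close>

lemma hahn_banach_linear_below:
  fixes p :: "'v::real_vector \<Rightarrow> real"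
  assumes p: "sublinear p"
  obtains f where "linear f" "\<forall>x. f x \<le> p x"
proof -
  obtain q where q: "sublinear q" "q \<le> p" and min: "\<forall>q'. sublinear q' \<longrightarrow> q' \<le> q \<longrightarrow> q' = q"
    by (rule minimal_sublinear_exists[OF p])
  have odd: "q (- y) = - q y" for y
  proof -
    obtain q' where q': "sublinear q'" "q' \<le> q" "q' (- y) \<le> - q y"
      by (rule sublinear_below_along[OF q(1)])
    then have "q' = q" using min by blast
    with q'(3) have "q (- y) \<le> - q y" by simp
    with sublinear_ge_minus[OF q(1), of y] show ?thesis by simp
  qed
  have "linear q"
  proof (rule linearI)
    fix x y
    have "q (- x + - y) \<le> q (- x) + q (- y)" by (rule sublinear_add[OF q(1)])
    then have "q (- (x + y)) \<le> q (- x) + q (- y)" by simp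
    then have "- q (x + y) \<le> - q x + - q y" by (simp only: odd)
    with sublinear_add[OF q(1), of x y] show "q (x + y) = q x + q y" by simp
    fix r :: real
    show "q (r *\<^sub>R x) = r *\<^sub>R q x"
      using sublinear_scale[OF q(1), of r x] sublinear_scale[OF q(1), of "- r" x] odd[of "r *\<^sub>R x"]
      by (cases "0 \<le> r") auto
  qed
  then show thesis using that q(2) by (auto simp: le_fun_def)
qed

lemma hahn_banach_norming_real:
  fixes x0 :: "'v::real_normed_vector"
  obtains f where "linear f" "\<forall>x. f x \<le> norm x" "f x0 = norm x0"
proof -
  have "sublinear (norm :: 'v \<Rightarrow> real)" by (simp add: sublinear_def norm_triangle_ineq)
  \<comment> \<open>Lowering the norm along \<open>x0\<close> first makes every linear functional below it take the value \<open>norm x0\<close> at \<open>x0\<close>.\<close>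
  then obtain q where q: "sublinear q" "q \<le> norm" "q (- x0) \<le> - norm x0"
    by (rule sublinear_below_along)
  obtain f where f: "linear f" "\<forall>x. f x \<le> q x" by (rule hahn_banach_linear_below[OF q(1)])
  have le: "f x \<le> norm x" for x
    using f(2) q(2) by (auto simp: le_fun_def intro: order_trans)
  have "f (- x0) \<le> - norm x0" using f(2) q(3) order_trans by blast
  then have "norm x0 \<le> f x0" using linear_neg[OF f(1)] by simp
  with le[of x0] have "f x0 = norm x0" by (rule antisym)
  with le show thesis using that[OF f(1)] by blast
qed


section \<open>Scalars and spaces over them\<close>

locale scalar_space =
  fixes sc :: "'k::real_normed_field \<Rightarrow> 'y::real_normed_vector \<Rightarrow> 'y"
  assumes sc_add_right: "sc c (x + y) = sc c x + sc c y"
    and sc_add_left: "sc (c + d) x = sc c x + sc d x"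
    and sc_sc: "sc c (sc d x) = sc (c * d) x"
    and sc_of_real: "sc (of_real r) x = r *\<^sub>R x"
    and norm_sc: "norm (sc c x) = norm c * norm x"
begin

lemma sc_one [simp]: "sc 1 x = x"
  using sc_of_real[of 1 x] by simp

lemma bounded_bilinear_sc: "bounded_bilinear sc"
proof
  show "sc (r *\<^sub>R c) x = r *\<^sub>R sc c x" for r c x
    by (metis sc_of_real sc_sc scaleR_conv_of_real)
  show "sc c (r *\<^sub>R x) = r *\<^sub>R sc c x" for r c x
    by (metis sc_of_real sc_sc mult.commute)
  show "\<exists>K. \<forall>a b. norm (sc a b) \<le> norm a * norm b * K"
    by (rule exI[of _ 1]) (simp add: norm_sc)
qed (simp_all add: sc_add_right sc_add_left)

sublocale sc: bounded_bilinear sc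
  by (rule bounded_bilinear_sc)

lemma functionalsI:
  assumes "\<And>x y. f (x + y) = f x + f y" "\<And>c x. f (sc c x) = c * f x"
    "\<And>x. norm (f x) \<le> K * norm x"
  shows "f \<in> functionals sc"
proof -
  have "bounded_linear f"
  proof (rule bounded_linear_intro[OF assms(1)])
    show "f (r *\<^sub>R x) = r *\<^sub>R f x" for r x
      using assms(2)[of "of_real r" x] by (simp add: sc_of_real scaleR_conv_of_real)
    show "norm (f x) \<le> norm x * K" for x using assms(3)[of x] by (simp add: mult.commute)
  qed
  with assms(2) show ?thesis by (simp add: functionals_def)
qed

end

lemma functionals_bounded_linear: "f \<in> functionals sc \<Longrightarrow> bounded_linear f"
  by (simp add: functionals_def)

lemma functionals_sc: "f \<in> functionals sc \<Longrightarrow> f (sc c x) = c * f x"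
  by (simp add: functionals_def)

lemma functionals_bound: "f \<in> functionals sc \<Longrightarrow> norm (f x) \<le> onorm f * norm x"
  by (simp add: functionals_def onorm)

lemma norm_one_phase:
  fixes a :: "'k::real_normed_field"
  obtains \<theta> where "norm \<theta> = 1" "\<theta> * a = of_real (norm a)"
proof (cases "a = 0")
  case True
  then show thesis using that[of 1] by simp
next
  case False
  then show thesis using that[of "of_real (norm a) / a"] by (simp add: norm_divide)
qed

text \<open>
  With a conjugation at hand, the inner product of the scalar field is the real part of a product of
  scalars.  Taking real parts is what connects functionals over the scalars with real functionals.
\<close>

locale scalar_conjugation =
  fixes conj :: "'k::{real_normed_field,euclidean_space} \<Rightarrow> 'k"
  assumes linear_conj: "linear conj"
    and conj_conj [simp]: "conj (conj a) = a"
    and conj_one [simp]: "conj 1 = 1"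
    and inner_conj: "a \<bullet> b = (conj a * b) \<bullet> 1"

locale conjugation_space = scalar_conjugation conj + scalar_space sc
  for conj :: "'k::{real_normed_field,euclidean_space} \<Rightarrow> 'k"
    and sc :: "'k \<Rightarrow> 'y::real_normed_vector \<Rightarrow> 'y"
begin

text \<open>
  A real functional is the real part of one over the scalars (Bohnenblust and Sobczyk).  For complex
  scalars the sum over the basis in the proof is the familiar \<open>f x - i f (i x)\<close>.
\<close>

lemma functional_with_real_part:
  fixes f :: "'y \<Rightarrow> real"
  assumes f: "linear f" and le: "\<forall>x. f x \<le> norm x"
  obtains F where "F \<in> functionals sc" "\<forall>x. norm (F x) \<le> norm x" "\<forall>x. F x \<bullet> 1 = f x"
proof -
  define F where "F x = (\<Sum>b\<in>Basis. f (sc (conj b) x) *\<^sub>R b)" for x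
  have inner_F: "a \<bullet> F x = f (sc (conj a) x)" for a x
  proof -
    have l: "linear (\<lambda>a. f (sc (conj a) x))"
      using linear_compose[OF linear_compose[OF linear_conj bounded_linear.linear[OF sc.bounded_linear_left[of x]]] f]
      by (simp add: o_def)
    have "a \<bullet> F x = (\<Sum>b\<in>Basis. (a \<bullet> b) *\<^sub>R f (sc (conj b) x))"
      by (simp add: F_def inner_sum_right mult.commute)
    also have "\<dots> = f (sc (conj (\<Sum>b\<in>Basis. (a \<bullet> b) *\<^sub>R b)) x)"
      using linear_sum[OF l, of "\<lambda>b. (a \<bullet> b) *\<^sub>R b" Basis] linear_scale[OF l] by simp
    finally show ?thesis by (simp add: euclidean_representation)
  qed
  have sc: "F (sc c x) = c * F x" for c x
  proof (rule euclidean_eqI)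
    fix b :: 'k
    have "F (sc c x) \<bullet> b = f (sc (conj b) (sc c x))" by (subst inner_commute) (rule inner_F)
    also have "\<dots> = conj (conj b * c) \<bullet> F x" by (simp add: inner_F sc_sc)
    also have "\<dots> = (conj b * (c * F x)) \<bullet> 1"
      by (subst inner_conj) (simp add: mult.assoc)
    also have "\<dots> = (c * F x) \<bullet> b" by (subst inner_commute) (rule inner_conj[symmetric])
    finally show "F (sc c x) \<bullet> b = (c * F x) \<bullet> b" .
  qed
  have re: "F x \<bullet> 1 = f x" for x using inner_F[of 1 x] by (simp add: inner_commute)
  have bound: "norm (F x) \<le> norm x" for x
  proof -
    obtain \<theta> where \<theta>: "norm \<theta> = 1" "\<theta> * F x = of_real (norm (F x))" by (rule norm_one_phase)
    have "norm (F x) = of_real (norm (F x)) \<bullet> (1::'k)"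
      by (simp add: of_real_def power2_norm_eq_inner[symmetric])
    also have "\<dots> = f (sc \<theta> x)" by (simp add: \<theta>(2)[symmetric] sc[symmetric] re)
    also have "\<dots> \<le> norm x" using spec[OF le, of "sc \<theta> x"] by (simp add: norm_sc \<theta>)
    finally show ?thesis .
  qed
  have add: "F (x + y) = F x + F y" for x y
    by (simp add: F_def sc_add_right linear_add[OF f] scaleR_add_left sum.distrib)
  have "F \<in> functionals sc"
    by (rule functionalsI[where K=1]) (simp_all add: add sc bound)
  then show thesis using that bound re by blast
qed

lemma norming_functional:
  assumes "x \<noteq> 0"
  obtains F where "F \<in> functionals sc" "onorm F = 1" "F x = of_real (norm x)"
proof -
  obtain f :: "'y \<Rightarrow> real" where f: "linear f" "\<forall>y. f y \<le> norm y" "f x = norm x"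
    by (rule hahn_banach_norming_real)
  obtain F where F: "F \<in> functionals sc" "\<forall>x. norm (F x) \<le> norm x" "\<forall>x. F x \<bullet> 1 = f x"
    by (rule functional_with_real_part[OF f(1,2)])
  have sq: "norm (F x) \<le> norm x" "F x \<bullet> 1 = norm x" using F(2) F(3) f(3) by simp_all
  \<comment> \<open>A scalar of modulus at most \<open>norm x\<close> whose real part is \<open>norm x\<close> equals \<open>norm x\<close>.\<close>
  have "(F x - norm x *\<^sub>R 1) \<bullet> (F x - norm x *\<^sub>R 1) = F x \<bullet> F x - 2 * norm x * (F x \<bullet> 1) + (norm x)\<^sup>2 * (1 \<bullet> (1::'k))"
    by (simp add: inner_diff_left inner_diff_right inner_commute power2_eq_square algebra_simps del: inner_eq_zero_iff)
  then have "(norm (F x - norm x *\<^sub>R 1))\<^sup>2 = (norm (F x))\<^sup>2 - 2 * norm x * (F x \<bullet> 1) + (norm x)\<^sup>2"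
    by (simp only: dot_square_norm) simp
  also have "\<dots> \<le> 0" using sq power_mono[OF sq(1), of 2] by (simp add: power2_eq_square)
  finally have Fx: "F x = of_real (norm x)" by (simp add: of_real_def)
  have "onorm F \<le> 1" by (rule onorm_bound) (simp_all add: F)
  moreover have "1 \<le> onorm F"
    using functionals_bound[OF F(1), of x] Fx assms by simp
  ultimately show thesis using that[OF F(1)] Fx by simp
qed

end


section \<open>Quadratic polynomials\<close>

lemma bilinear_maps_bounded_bilinear: "B \<in> bilinear_maps sc \<Longrightarrow> bounded_bilinear B"
  and bilinear_maps_sc_left: "B \<in> bilinear_maps sc \<Longrightarrow> B (sc c x) y = sc c (B x y)"
  and bilinear_maps_sc_right: "B \<in> bilinear_maps sc \<Longrightarrow> B x (sc c y) = sc c (B x y)"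
  by (simp_all add: bilinear_maps_def)

lemma symmetric_polarization:
  fixes B :: "'y::real_normed_vector \<Rightarrow> 'y \<Rightarrow> 'z::real_normed_vector"
  assumes B: "bounded_bilinear B" and sym: "\<And>x y. B x y = B y x"
  shows "B x y = (1/4) *\<^sub>R (B (x + y) (x + y) - B (x - y) (x - y))"
proof -
  interpret B: bounded_bilinear B by (rule B)
  have "B (x + y) (x + y) - B (x - y) (x - y) = B x y + B x y + B x y + B x y"
    using sym[of y x] by (simp add: B.add_left B.add_right B.diff_left B.diff_right algebra_simps)
  also have "\<dots> = 4 *\<^sub>R B x y"
  proof -
    have "(4::real) = 1 + 1 + 1 + 1" by simp
    then show ?thesis by (simp only: scaleR_add_left scaleR_one)
  qed
  finally show ?thesis by simp
qed

lemma polar_pairsD: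
  assumes "(x, f) \<in> polar_pairs sc"
  shows "norm x = 1" "f \<in> functionals sc" "onorm f = 1" "f x = 1" "norm (f y) \<le> norm y"
  using assms functionals_bound[of f sc y] by (auto simp: polar_pairs_def)

context scalar_space
begin

lemma bilinear_mapsI:
  assumes "\<And>x y z. B (x + y) z = B x z + B y z" "\<And>x y z. B x (y + z) = B x y + B x z"
    and "\<And>c x y. B (sc c x) y = sc c (B x y)" "\<And>c x y. B x (sc c y) = sc c (B x y)"
    and "\<And>x y. norm (B x y) \<le> K * norm x * norm y"
  shows "B \<in> bilinear_maps sc"
proof -
  have "bounded_bilinear B"
  proof
    show "B (r *\<^sub>R x) y = r *\<^sub>R B x y" "B x (r *\<^sub>R y) = r *\<^sub>R B x y" for r x y
      using assms(3)[of "of_real r" x y] assms(4)[of x "of_real r" y] by (simp_all add: sc_of_real)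
    show "\<exists>K. \<forall>a b. norm (B a b) \<le> norm a * norm b * K"
      using assms(5) by (intro exI[of _ K]) (simp add: mult_ac)
  qed (simp_all add: assms)
  with assms show ?thesis by (simp add: bilinear_maps_def)
qed

lemma poly2_symmetric:
  assumes "P \<in> poly2 sc"
  obtains B where "B \<in> bilinear_maps sc" "\<forall>x y. B x y = B y x" "\<forall>x. P x = B x x"
proof -
  obtain C where C: "C \<in> bilinear_maps sc" "\<And>x. P x = C x x"
    using assms by (auto simp: poly2_def)
  interpret C: bounded_bilinear C by (rule bilinear_maps_bounded_bilinear[OF C(1)])
  obtain K where K: "\<And>x y. norm (C x y) \<le> norm x * norm y * K" using C.bounded by blast
  define B where "B x y = (1/2) *\<^sub>R (C x y + C y x)" for x y
  have "B \<in> bilinear_maps sc"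
  proof (rule bilinear_mapsI)
    fix x y z c
    show "B (x + y) z = B x z + B y z" "B x (y + z) = B x y + B x z"
      by (simp_all add: B_def C.add_left C.add_right algebra_simps)
    show "B (sc c x) y = sc c (B x y)" "B x (sc c y) = sc c (B x y)"
      by (simp_all add: B_def bilinear_maps_sc_left[OF C(1)] bilinear_maps_sc_right[OF C(1)]
          sc.scaleR_right sc.add_right)
    have "norm (C x y + C y x) \<le> 2 * (K * norm x * norm y)"
      using norm_triangle_ineq[of "C x y" "C y x"] K[of x y] K[of y x] by (simp add: mult_ac)
    then show "norm (B x y) \<le> K * norm x * norm y" by (simp add: B_def)
  qed
  moreover have "B x y = B y x" for x y by (simp add: B_def add.commute)
  moreover have "P x = B x x" for x
    by (simp add: B_def C(2) scaleR_2[symmetric])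
  ultimately show thesis using that by blast
qed

lemma symmetric_bilinear_properties:
  assumes "P \<in> poly2 sc"
  shows "symmetric_bilinear sc P \<in> bilinear_maps sc"
    and "symmetric_bilinear sc P x y = symmetric_bilinear sc P y x"
    and "P x = symmetric_bilinear sc P x x"
proof -
  obtain B where B: "B \<in> bilinear_maps sc" "\<forall>x y. B x y = B y x" "\<forall>x. P x = B x x"
    by (rule poly2_symmetric[OF assms])
  have "C = B" if C: "C \<in> bilinear_maps sc" "\<forall>x y. C x y = C y x" "\<forall>x. P x = C x x" for C
  proof (intro ext)
    fix x y
    show "C x y = B x y"
      using symmetric_polarization[OF bilinear_maps_bounded_bilinear[OF C(1)], of x y]
        symmetric_polarization[OF bilinear_maps_bounded_bilinear[OF B(1)], of x y] B(2,3) C(2,3) by simp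
  qed
  then have "symmetric_bilinear sc P = B"
    unfolding symmetric_bilinear_def using B by (intro the_equality) auto
  with B show "symmetric_bilinear sc P \<in> bilinear_maps sc"
    "symmetric_bilinear sc P x y = symmetric_bilinear sc P y x"
    "P x = symmetric_bilinear sc P x x" by simp_all
qed

lemma poly2_bound:
  assumes "P \<in> poly2 sc"
  obtains K where "0 < K" "\<forall>x. norm (P x) \<le> K * (norm x)\<^sup>2"
proof -
  obtain B where B: "B \<in> bilinear_maps sc" "\<And>x. P x = B x x"
    using assms by (auto simp: poly2_def)
  obtain K where "0 < K" "\<forall>x y. norm (B x y) \<le> norm x * norm y * K"
    using bounded_bilinear.pos_bounded[OF bilinear_maps_bounded_bilinear[OF B(1)]] by blast
  then show thesis using that[of K] B(2) by (simp add: power2_eq_square mult_ac)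
qed

lemma poly2_scaleR: "P \<in> poly2 sc \<Longrightarrow> P (r *\<^sub>R x) = r\<^sup>2 *\<^sub>R P x"
  by (auto simp: poly2_def power2_eq_square bounded_bilinear.scaleR_left bounded_bilinear.scaleR_right
      dest!: bilinear_maps_bounded_bilinear)

lemma poly2_zero: "P \<in> poly2 sc \<Longrightarrow> P 0 = 0"
  using poly2_scaleR[of P 0 0] by simp

lemma poly2_add:
  assumes "P \<in> poly2 sc" "Q \<in> poly2 sc"
  shows "(\<lambda>x. P x + Q x) \<in> poly2 sc"
proof -
  obtain B C where B: "B \<in> bilinear_maps sc" "\<And>x. P x = B x x"
    and C: "C \<in> bilinear_maps sc" "\<And>x. Q x = C x x"
    using assms by (auto simp: poly2_def)
  interpret B: bounded_bilinear B by (rule bilinear_maps_bounded_bilinear[OF B(1)])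
  interpret C: bounded_bilinear C by (rule bilinear_maps_bounded_bilinear[OF C(1)])
  obtain K L where K: "\<And>x y. norm (B x y) \<le> norm x * norm y * K"
    and L: "\<And>x y. norm (C x y) \<le> norm x * norm y * L" using C.bounded B.bounded by blast
  have "(\<lambda>x y. B x y + C x y) \<in> bilinear_maps sc"
  proof (rule bilinear_mapsI)
    show "norm (B x y + C x y) \<le> (K + L) * norm x * norm y" for x y
      using norm_triangle_ineq[of "B x y" "C x y"] K[of x y] L[of x y] by (simp add: algebra_simps)
  qed (simp_all add: B.add_left B.add_right C.add_left C.add_right sc.add_right
      bilinear_maps_sc_left[OF B(1)] bilinear_maps_sc_right[OF B(1)]
      bilinear_maps_sc_left[OF C(1)] bilinear_maps_sc_right[OF C(1)])
  then show ?thesis using B(2) C(2) by (auto simp: poly2_def)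
qed

lemma poly2_wuD: "P \<in> poly2_wu sc \<Longrightarrow> P \<in> poly2 sc"
  by (simp add: poly2_wu_def)

lemma poly2_wu_continuity:
  assumes "P \<in> poly2_wu sc" "bounded A" "0 < \<epsilon>"
  obtains \<Phi> \<eta> where "finite \<Phi>" "\<Phi> \<subseteq> functionals sc" "0 < \<eta>"
    "\<forall>x\<in>A. \<forall>y\<in>A. (\<forall>\<phi>\<in>\<Phi>. norm (\<phi> (x - y)) < \<eta>) \<longrightarrow> norm (P x - P y) < \<epsilon>"
proof -
  have "\<exists>\<Phi> \<eta>. finite \<Phi> \<and> \<Phi> \<subseteq> functionals sc \<and> \<eta> > 0 \<and>
       (\<forall>x \<in> A. \<forall>y \<in> A. (\<forall>\<phi> \<in> \<Phi>. norm (\<phi> (x - y)) < \<eta>) \<longrightarrow> norm (P x - P y) < \<epsilon>)"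
    using assms by (simp add: poly2_wu_def)
  then show thesis by (elim exE conjE) (rule that)
qed

lemma poly2_wuI:
  assumes "P \<in> poly2 sc"
    and "\<And>A \<epsilon>. bounded A \<Longrightarrow> 0 < \<epsilon> \<Longrightarrow> \<exists>\<Phi> \<eta>. finite \<Phi> \<and> \<Phi> \<subseteq> functionals sc \<and> \<eta> > 0 \<and>
       (\<forall>x \<in> A. \<forall>y \<in> A. (\<forall>\<phi> \<in> \<Phi>. norm (\<phi> (x - y)) < \<eta>) \<longrightarrow> norm (P x - P y) < \<epsilon>)"
  shows "P \<in> poly2_wu sc"
  using assms unfolding poly2_wu_def by blast

lemma poly2_wu_add:
  assumes P: "P \<in> poly2_wu sc" and Q: "Q \<in> poly2_wu sc"
  shows "(\<lambda>x. P x + Q x) \<in> poly2_wu sc"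
proof (rule poly2_wuI)
  show "(\<lambda>x. P x + Q x) \<in> poly2 sc" using P Q by (intro poly2_add poly2_wuD)
  fix A :: "'y set" and \<epsilon> :: real assume A: "bounded A" and \<epsilon>: "0 < \<epsilon>"
  obtain \<Phi> \<eta> where 1: "finite \<Phi>" "\<Phi> \<subseteq> functionals sc" "0 < \<eta>"
    "\<forall>x\<in>A. \<forall>y\<in>A. (\<forall>\<phi>\<in>\<Phi>. norm (\<phi> (x - y)) < \<eta>) \<longrightarrow> norm (P x - P y) < \<epsilon>/2"
    by (rule poly2_wu_continuity[OF P A half_gt_zero[OF \<epsilon>]])
  obtain \<Psi> \<zeta> where 2: "finite \<Psi>" "\<Psi> \<subseteq> functionals sc" "0 < \<zeta>"
    "\<forall>x\<in>A. \<forall>y\<in>A. (\<forall>\<phi>\<in>\<Psi>. norm (\<phi> (x - y)) < \<zeta>) \<longrightarrow> norm (Q x - Q y) < \<epsilon>/2"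
    by (rule poly2_wu_continuity[OF Q A half_gt_zero[OF \<epsilon>]])
  have "norm (P x + Q x - (P y + Q y)) < \<epsilon>"
    if "x \<in> A" "y \<in> A" "\<forall>\<phi>\<in>\<Phi> \<union> \<Psi>. norm (\<phi> (x - y)) < min \<eta> \<zeta>" for x y
  proof -
    have "norm (P x - P y) < \<epsilon>/2" "norm (Q x - Q y) < \<epsilon>/2" using 1(4) 2(4) that by auto
    then show ?thesis
      using norm_triangle_ineq[of "P x - P y" "Q x - Q y"] by (simp add: algebra_simps)
  qed
  then show "\<exists>\<Phi> \<eta>. finite \<Phi> \<and> \<Phi> \<subseteq> functionals sc \<and> \<eta> > 0 \<and>
       (\<forall>x \<in> A. \<forall>y \<in> A. (\<forall>\<phi> \<in> \<Phi>. norm (\<phi> (x - y)) < \<eta>) \<longrightarrow> norm (P x + Q x - (P y + Q y)) < \<epsilon>)"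
    using 1 2 by (intro exI[of _ "\<Phi> \<union> \<Psi>"] exI[of _ "min \<eta> \<zeta>"]) auto
qed

text \<open>
  These are the perturbations that will be added.  They are weakly uniformly continuous because
  \<open>(f x)\<^sup>2 - (f y)\<^sup>2 = f (x - y) (f x + f y)\<close>, and the second factor is bounded on bounded sets.
\<close>

lemma poly2_wu_rank_one:
  assumes f: "f \<in> functionals sc"
  shows "(\<lambda>x. sc (c * (f x)\<^sup>2) z) \<in> poly2_wu sc"
proof (rule poly2_wuI)
  interpret f: bounded_linear f by (rule functionals_bounded_linear[OF f])
  define K where "K = onorm f"
  have K: "norm (f x) \<le> K * norm x" "0 \<le> K" for x
    using functionals_bound[OF f] onorm_pos_le[OF functionals_bounded_linear[OF f]] by (simp_all add: K_def)
  have "(\<lambda>x y. sc (c * (f x * f y)) z) \<in> bilinear_maps sc"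
  proof (rule bilinear_mapsI)
    show "norm (sc (c * (f x * f y)) z) \<le> (norm c * K * K * norm z) * norm x * norm y" for x y
    proof -
      have "norm (f x) * norm (f y) \<le> (K * norm x) * (K * norm y)"
        using K by (intro mult_mono) auto
      then have "(norm c * norm z) * (norm (f x) * norm (f y)) \<le> (norm c * norm z) * ((K * norm x) * (K * norm y))"
        by (intro mult_left_mono) auto
      then show ?thesis by (simp add: norm_sc norm_mult mult_ac)
    qed
  qed (simp_all add: f.add functionals_sc[OF f] sc_sc sc_add_left[symmetric] algebra_simps)
  then show "(\<lambda>x. sc (c * (f x)\<^sup>2) z) \<in> poly2 sc"
    by (auto simp: poly2_def power2_eq_square)
  fix A :: "'y set" and \<epsilon> :: real assume A: "bounded A" and \<epsilon>: "0 < \<epsilon>"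
  obtain R where R: "\<And>x. x \<in> A \<Longrightarrow> norm x \<le> R" using A by (auto simp: bounded_iff)
  define M where "M = norm c * (2 * K * \<bar>R\<bar>) * norm z + 1"
  have M: "0 < M" using K by (simp add: M_def add_nonneg_pos)
  have "norm (sc (c * (f x)\<^sup>2) z - sc (c * (f y)\<^sup>2) z) < \<epsilon>"
    if "x \<in> A" "y \<in> A" "norm (f (x - y)) < \<epsilon> / M" for x y
  proof -
    have s: "norm (f x + f y) \<le> 2 * K * \<bar>R\<bar>"
    proof -
      have "norm (f v) \<le> K * \<bar>R\<bar>" if "v \<in> A" for v
        using K(1)[of v] mult_left_mono[OF order_trans[OF R[OF that] abs_ge_self] K(2)] by linarith
      from this[OF that(1)] this[OF that(2)] norm_triangle_ineq[of "f x" "f y"] show ?thesis by simp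
    qed
    have "sc (c * (f x)\<^sup>2) z - sc (c * (f y)\<^sup>2) z = sc (c * (f (x - y) * (f x + f y))) z"
      by (simp add: sc.diff_left[symmetric] f.diff power2_eq_square algebra_simps)
    then have "norm (sc (c * (f x)\<^sup>2) z - sc (c * (f y)\<^sup>2) z) = norm (f (x - y)) * (norm c * norm (f x + f y) * norm z)"
      by (simp add: norm_sc norm_mult)
    also have "\<dots> \<le> norm (f (x - y)) * (norm c * (2 * K * \<bar>R\<bar>) * norm z)"
      using s by (intro mult_left_mono mult_right_mono) auto
    also have "\<dots> \<le> norm (f (x - y)) * M" by (intro mult_left_mono) (auto simp: M_def)
    also have "\<dots> < \<epsilon>" using that(3) M by (simp add: field_simps)
    finally show ?thesis .
  qed
  then show "\<exists>\<Phi> \<eta>. finite \<Phi> \<and> \<Phi> \<subseteq> functionals sc \<and> \<eta> > 0 \<and>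
       (\<forall>x \<in> A. \<forall>y \<in> A. (\<forall>\<phi> \<in> \<Phi>. norm (\<phi> (x - y)) < \<eta>) \<longrightarrow>
         norm (sc (c * (f x)\<^sup>2) z - sc (c * (f y)\<^sup>2) z) < \<epsilon>)"
    using f \<epsilon> M by (intro exI[of _ "{f}"] exI[of _ "\<epsilon> / M"]) auto
qed

text \<open>
  By polarization the symmetric bilinear maps converge along with the polynomials, and bilinearity
  passes to the pointwise limit.  Boundedness has to be checked on unit vectors only.
\<close>

lemma poly2_limit:
  assumes P: "\<And>m. P m \<in> poly2 sc"
    and le: "\<And>m x. norm (Q x - P m x) \<le> r m * (norm x)\<^sup>2"
    and r: "r \<longlonglongrightarrow> 0"
  shows "Q \<in> poly2 sc"
proof -
  have lim: "(\<lambda>m. P m x) \<longlonglongrightarrow> Q x" for x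
  proof (rule LIM_zero_cancel, rule Lim_null_comparison)
    show "\<forall>\<^sub>F m in sequentially. norm (P m x - Q x) \<le> r m * (norm x)\<^sup>2"
      using le by (simp add: norm_minus_commute)
    show "(\<lambda>m. r m * (norm x)\<^sup>2) \<longlonglongrightarrow> 0" by (rule tendsto_mult_left_zero[OF r])
  qed
  define B where "B m = symmetric_bilinear sc (P m)" for m
  have B: "B m \<in> bilinear_maps sc" "P m x = B m x x" for m x
    unfolding B_def by (rule symmetric_bilinear_properties[OF P])+
  have polar: "B m x y = (1/4) *\<^sub>R (P m (x + y) - P m (x - y))" for m x y
    unfolding B(2) using symmetric_bilinear_properties[OF P]
    by (intro symmetric_polarization bilinear_maps_bounded_bilinear[OF B(1)]) (simp add: B_def)
  define C where "C x y = (1/4) *\<^sub>R (Q (x + y) - Q (x - y))" for x y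
  have limB: "(\<lambda>m. B m x y) \<longlonglongrightarrow> C x y" for x y
    unfolding polar C_def by (intro tendsto_intros lim)
  have B0: "bounded_bilinear (B m)" for m by (rule bilinear_maps_bounded_bilinear[OF B(1)])
  note B_simps = bounded_bilinear.add_left[OF B0] bounded_bilinear.add_right[OF B0]
    bilinear_maps_sc_left[OF B(1)] bilinear_maps_sc_right[OF B(1)]
  have C_scaleR: "C (a *\<^sub>R x) (b *\<^sub>R y) = (a * b) *\<^sub>R C x y" for a b x y
  proof (rule LIMSEQ_unique[OF limB])
    have "(\<lambda>m. (a * b) *\<^sub>R B m x y) \<longlonglongrightarrow> (a * b) *\<^sub>R C x y" by (intro tendsto_intros limB)
    then show "(\<lambda>m. B m (a *\<^sub>R x) (b *\<^sub>R y)) \<longlonglongrightarrow> (a * b) *\<^sub>R C x y"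
      by (simp add: bounded_bilinear.scaleR_left[OF B0] bounded_bilinear.scaleR_right[OF B0] mult.commute)
  qed
  obtain K where K: "0 < K" "\<forall>x. norm (P 0 x) \<le> K * (norm x)\<^sup>2" by (rule poly2_bound[OF P])
  define L where "L = K + \<bar>r 0\<bar>"
  have L: "norm (Q x) \<le> L * (norm x)\<^sup>2" for x
  proof -
    have "norm (Q x) \<le> norm (Q x - P 0 x) + norm (P 0 x)" by (metis diff_add_cancel norm_triangle_ineq)
    also have "\<dots> \<le> \<bar>r 0\<bar> * (norm x)\<^sup>2 + K * (norm x)\<^sup>2"
      using le[of x 0] mult_right_mono[OF abs_ge_self[of "r 0"], of "(norm x)\<^sup>2"] spec[OF K(2), of x] by simp
    finally show ?thesis by (simp add: L_def algebra_simps)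
  qed
  have C1: "norm (C x y) \<le> 2 * L" if "norm x = 1" "norm y = 1" for x y
  proof -
    have L0: "0 \<le> L" using K by (simp add: L_def)
    have "norm (Q (x + y)) \<le> L * 4" "norm (Q (x - y)) \<le> L * 4"
      using L[of "x + y"] L[of "x - y"] that
        mult_left_mono[OF power_mono[of "norm (x + y)" 2 2] L0]
        mult_left_mono[OF power_mono[of "norm (x - y)" 2 2] L0]
        norm_triangle_ineq[of x y] norm_triangle_ineq4[of x y] by simp_all
    then show ?thesis unfolding C_def using norm_triangle_ineq4[of "Q (x + y)" "Q (x - y)"] by simp
  qed
  have "C \<in> bilinear_maps sc"
  proof (rule bilinear_mapsI)
    fix x y z c
    show "C (x + y) z = C x z + C y z"
      by (rule LIMSEQ_unique[OF limB]) (simp add: B_simps tendsto_add limB)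
    show "C x (y + z) = C x y + C x z"
      by (rule LIMSEQ_unique[OF limB]) (simp add: B_simps tendsto_add limB)
    show "C (sc c x) y = sc c (C x y)" "C x (sc c y) = sc c (C x y)"
      by (rule LIMSEQ_unique[OF limB]; simp add: B_simps sc.tendsto limB)+
    show "norm (C x y) \<le> (2 * L) * norm x * norm y"
    proof (cases "x = 0 \<or> y = 0")
      case True
      then show ?thesis using C_scaleR[of 0 x 1 y] C_scaleR[of 1 x 0 y] by auto
    next
      case False
      have "C x y = (norm x * norm y) *\<^sub>R C (sgn x) (sgn y)"
        using False by (simp add: C_scaleR[symmetric] sgn_div_norm)
      with False C1[of "sgn x" "sgn y"] show ?thesis
        by (simp add: norm_sgn mult_right_mono mult_ac)
    qed
  qed
  moreover have "Q x = C x x" for x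
  proof (rule LIMSEQ_unique[OF lim])
    show "(\<lambda>m. P m x) \<longlonglongrightarrow> C x x" using limB[of x x] by (simp add: B(2))
  qed
  ultimately show ?thesis by (auto simp: poly2_def)
qed

lemma poly2_wu_limit:
  assumes P: "\<And>m. P m \<in> poly2_wu sc"
    and le: "\<And>m x. norm (Q x - P m x) \<le> r m * (norm x)\<^sup>2"
    and r: "r \<longlonglongrightarrow> 0"
  shows "Q \<in> poly2_wu sc"
proof (rule poly2_wuI)
  show "Q \<in> poly2 sc" by (rule poly2_limit[OF poly2_wuD[OF P] le r])
  fix A :: "'y set" and \<epsilon> :: real assume A: "bounded A" and \<epsilon>: "0 < \<epsilon>"
  have \<epsilon>3: "0 < \<epsilon>/3" using \<epsilon> by simp
  obtain R where R: "\<And>x. x \<in> A \<Longrightarrow> norm x \<le> R" using A by (auto simp: bounded_iff)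
  have "(\<lambda>m. r m * R\<^sup>2) \<longlonglongrightarrow> 0" by (rule tendsto_mult_left_zero[OF r])
  then have "\<forall>\<^sub>F m in sequentially. r m * R\<^sup>2 < \<epsilon>/3"
    by (rule order_tendstoD(2)) (use \<epsilon> in simp)
  then obtain m where m: "r m * R\<^sup>2 < \<epsilon>/3" by (auto simp: eventually_sequentially)
  have close: "norm (Q x - P m x) < \<epsilon>/3" if "x \<in> A" for x
  proof (cases "0 \<le> r m")
    case True
    have "r m * (norm x)\<^sup>2 \<le> r m * R\<^sup>2" using R[OF that] True by (intro mult_left_mono power_mono) auto
    then show ?thesis using le[of x m] m by linarith
  next
    case False
    then have "r m * (norm x)\<^sup>2 \<le> 0" by (simp add: mult_nonpos_nonneg)
    then show ?thesis using le[of x m] \<epsilon> by linarith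
  qed
  obtain \<Phi> \<eta> where 1: "finite \<Phi>" "\<Phi> \<subseteq> functionals sc" "0 < \<eta>"
    "\<forall>x\<in>A. \<forall>y\<in>A. (\<forall>\<phi>\<in>\<Phi>. norm (\<phi> (x - y)) < \<eta>) \<longrightarrow> norm (P m x - P m y) < \<epsilon>/3"
    by (rule poly2_wu_continuity[OF P A \<epsilon>3])
  have "norm (Q x - Q y) < \<epsilon>" if "x \<in> A" "y \<in> A" "\<forall>\<phi>\<in>\<Phi>. norm (\<phi> (x - y)) < \<eta>" for x y
  proof -
    have "norm (Q x - Q y) = norm ((Q x - P m x) + (P m x - P m y) - (Q y - P m y))" by simp
    also have "\<dots> \<le> norm (Q x - P m x) + norm (P m x - P m y) + norm (Q y - P m y)"
      by (rule order_trans[OF norm_triangle_ineq4]) (intro add_mono norm_triangle_ineq order_refl)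
    also have "\<dots> < \<epsilon>" using close[OF that(1)] close[OF that(2)] bspec[OF bspec[OF 1(4) that(1)] that(2)] that(3)
      by linarith
    finally show ?thesis .
  qed
  then show "\<exists>\<Phi> \<eta>. finite \<Phi> \<and> \<Phi> \<subseteq> functionals sc \<and> \<eta> > 0 \<and>
       (\<forall>x \<in> A. \<forall>y \<in> A. (\<forall>\<phi> \<in> \<Phi>. norm (\<phi> (x - y)) < \<eta>) \<longrightarrow> norm (Q x - Q y) < \<epsilon>)"
    using 1 by blast
qed


section \<open>The numerical radius\<close>

lemma num_radius_upper:
  assumes P: "P \<in> poly2 sc" and xf: "(x, f) \<in> polar_pairs sc"
  shows "norm (f (P x)) \<le> num_radius sc P"
proof -
  obtain K where K: "\<forall>x. norm (P x) \<le> K * (norm x)\<^sup>2" by (rule poly2_bound[OF P])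
  have "norm (g (P y)) \<le> K" if "(y, g) \<in> polar_pairs sc" for y g
    using polar_pairsD(5)[OF that, of "P y"] spec[OF K, of y] polar_pairsD(1)[OF that] by simp
  then have "bdd_above ((\<lambda>(y, f). norm (f (P y))) ` polar_pairs sc)"
    by (intro bdd_aboveI2[where M=K]) auto
  from cSUP_upper[OF xf this] show ?thesis by (simp add: num_radius_def)
qed

lemma num_radius_least:
  assumes "polar_pairs sc \<noteq> {}" "\<And>x f. (x, f) \<in> polar_pairs sc \<Longrightarrow> norm (f (P x)) \<le> r"
  shows "num_radius sc P \<le> r"
  unfolding num_radius_def using assms by (intro cSUP_least) auto

lemma num_radius_nonneg:
  assumes "P \<in> poly2 sc" "polar_pairs sc \<noteq> {}"
  shows "0 \<le> num_radius sc P"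
proof -
  obtain x f where "(x, f) \<in> polar_pairs sc" using assms(2) by auto
  from num_radius_upper[OF assms(1) this] show ?thesis by (rule order_trans[OF norm_ge_zero])
qed

lemma num_radius_near_attained:
  assumes "polar_pairs sc \<noteq> {}" "r < num_radius sc P"
  obtains x f where "(x, f) \<in> polar_pairs sc" "r < norm (f (P x))"
  using num_radius_least[OF assms(1), of P r] assms(2) by (meson not_le)

lemma num_radius_perturb:
  assumes ne: "polar_pairs sc \<noteq> {}" and Q: "Q \<in> poly2 sc"
    and le: "\<And>x. norm x = 1 \<Longrightarrow> norm (P x - Q x) \<le> r"
  shows "num_radius sc P \<le> num_radius sc Q + r"
proof (rule num_radius_least[OF ne])
  fix x f assume xf: "(x, f) \<in> polar_pairs sc"
  interpret f: bounded_linear f by (rule functionals_bounded_linear[OF polar_pairsD(2)[OF xf]])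
  have "norm (f (P x)) \<le> norm (f (Q x)) + norm (f (P x - Q x))"
    using norm_triangle_ineq[of "f (Q x)" "f (P x - Q x)"] by (simp add: f.diff)
  also have "\<dots> \<le> num_radius sc Q + r"
    using num_radius_upper[OF Q xf] polar_pairsD(5)[OF xf, of "P x - Q x"] le[OF polar_pairsD(1)[OF xf]]
    by linarith
  finally show "norm (f (P x)) \<le> num_radius sc Q + r" .
qed

end

context conjugation_space
begin

lemma norming_polar_pair:
  assumes "y \<noteq> 0"
  obtains f where "(sgn y, f) \<in> polar_pairs sc" "f y = of_real (norm y)"
proof -
  obtain F where F: "F \<in> functionals sc" "onorm F = 1" "F y = of_real (norm y)"
    by (rule norming_functional[OF assms])
  have "F (sgn y) = 1"
    using linear_scale[OF bounded_linear.linear[OF functionals_bounded_linear[OF F(1)]], of "inverse (norm y)" y] assms F(3)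
    by (simp add: sgn_div_norm scaleR_conv_of_real)
  then have "(sgn y, F) \<in> polar_pairs sc" using F assms by (simp add: polar_pairs_def norm_sgn)
  then show thesis using that F(3) by blast
qed

text \<open>
  This is half of Lumer's formula for the numerical radius.  Let \<open>f\<close> norm \<open>y = x + c P(x)\<close>.  Replacing
  \<open>P x\<close> by \<open>P y\<close> in \<open>f y = f x + c f (P x)\<close> costs only a term of order \<open>|c|\<^sup>2\<close>, and \<open>f (P y)\<close> is
  controlled by the numerical radius because \<open>f\<close> and the normalized \<open>y\<close> form a polar pair.
\<close>

lemma norm_perturbation_le_num_radius:
  assumes P: "P \<in> poly2 sc" and ne: "polar_pairs sc \<noteq> {}"
  obtains C where "\<forall>c x. norm c \<le> 1 \<longrightarrow> norm x \<le> 1 \<longrightarrow>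
    norm (x + sc c (P x)) \<le> 1 + norm c * num_radius sc P + C * (norm c)\<^sup>2"
proof -
  obtain B where B: "B \<in> bilinear_maps sc" "\<And>x. P x = B x x"
    using P by (auto simp: poly2_def)
  interpret B: bounded_bilinear B by (rule bilinear_maps_bounded_bilinear[OF B(1)])
  obtain K where K: "0 < K" "\<And>x y. norm (B x y) \<le> norm x * norm y * K"
    using B.pos_bounded by blast
  define \<nu> where "\<nu> = num_radius sc P"
  have \<nu>: "0 \<le> \<nu>" unfolding \<nu>_def by (rule num_radius_nonneg[OF P ne])
  define C where "C = \<nu> * (2 * K + K\<^sup>2) + K\<^sup>2 * (2 + K)"
  have C: "0 \<le> C" using \<nu> K by (simp add: C_def)
  have "norm (x + sc c (P x)) \<le> 1 + norm c * \<nu> + C * (norm c)\<^sup>2"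
    if c: "norm c \<le> 1" and x: "norm x \<le> 1" for c x
  proof (cases "x + sc c (P x) = 0")
    case True
    have "0 \<le> norm c * \<nu> + C * (norm c)\<^sup>2" using \<nu> C by simp
    then show ?thesis unfolding True by simp
  next
    case False
    define t where "t = norm c"
    have t: "0 \<le> t" "t \<le> 1" using c by (simp_all add: t_def)
    define y where "y = x + sc c (P x)"
    obtain f where f: "(sgn y, f) \<in> polar_pairs sc" "f y = of_real (norm y)"
      using norming_polar_pair False unfolding y_def by blast
    interpret f: bounded_linear f by (rule functionals_bounded_linear[OF polar_pairsD(2)[OF f(1)]])
    have B1: "norm (B v w) \<le> a * b * K" if "norm v \<le> a" "norm w \<le> b" for v w a b
    proof -
      have "norm v * norm w * K \<le> a * b * K"
        using that K(1) order_trans[OF norm_ge_zero that(1)] by (intro mult_right_mono mult_mono) auto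
      then show ?thesis using K(2)[of v w] by simp
    qed
    have Px: "norm (P x) \<le> K" using B1[of x 1 x 1] x by (simp add: B(2))
    have yx: "norm (y - x) \<le> t * K"
      using Px t by (simp add: y_def norm_sc t_def mult_left_mono)
    have tK: "t * K \<le> K" using mult_right_mono[OF t(2), of K] K by simp
    have y: "norm y \<le> 1 + t * K"
      using norm_triangle_ineq[of x "y - x"] yx x by simp
    have "P y - P x = B (y - x) y + B x (y - x)"
      by (simp add: B(2) B.diff_left B.diff_right)
    then have "norm (P y - P x) \<le> t * K * (1 + t * K) * K + 1 * (t * K) * K"
      using norm_triangle_ineq[of "B (y - x) y" "B x (y - x)"] B1[OF yx y] B1[OF x yx] by simp
    also have "\<dots> \<le> t * K * (1 + K) * K + 1 * (t * K) * K"
      using tK K t by (intro add_mono mult_right_mono mult_left_mono) auto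
    also have "\<dots> = t * (K\<^sup>2 * (2 + K))" by (simp add: power2_eq_square algebra_simps)
    finally have diff: "norm (f (P y - P x)) \<le> t * (K\<^sup>2 * (2 + K))"
      using polar_pairsD(5)[OF f(1), of "P y - P x"] by simp
    have "y = norm y *\<^sub>R sgn y" using False by (simp add: sgn_div_norm y_def[symmetric])
    then have "P y = (norm y)\<^sup>2 *\<^sub>R P (sgn y)" using poly2_scaleR[OF P, of "norm y" "sgn y"] by simp
    then have "norm (f (P y)) = (norm y)\<^sup>2 * norm (f (P (sgn y)))" by (simp add: f.scaleR)
    also have "\<dots> \<le> (1 + t * (2 * K + K\<^sup>2)) * \<nu>"
    proof (rule mult_mono)
      have "(norm y)\<^sup>2 \<le> (1 + t * K)\<^sup>2" using y by (intro power_mono) auto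
      also have "\<dots> = 1 + t * (2 * K + t * K\<^sup>2)" by (simp add: power2_eq_square algebra_simps)
      also have "\<dots> \<le> 1 + t * (2 * K + 1 * K\<^sup>2)"
        using t by (intro add_left_mono mult_left_mono mult_right_mono) auto
      finally show "(norm y)\<^sup>2 \<le> 1 + t * (2 * K + K\<^sup>2)" by simp
      show "norm (f (P (sgn y))) \<le> \<nu>" unfolding \<nu>_def by (rule num_radius_upper[OF P f(1)])
    qed (use t K in auto)
    finally have Py: "norm (f (P y)) \<le> (1 + t * (2 * K + K\<^sup>2)) * \<nu>" .
    have "f y = f x + c * (f (P y) - f (P y - P x))"
      by (simp add: y_def[symmetric] f.diff functionals_sc[OF polar_pairsD(2)[OF f(1)], symmetric])
        (simp add: y_def f.add)
    then have "norm y = norm (f x + c * (f (P y) - f (P y - P x)))" using f(2) by (metis norm_of_real abs_norm_cancel)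
    also have "\<dots> \<le> norm (f x) + t * (norm (f (P y)) + norm (f (P y - P x)))"
      by (rule order_trans[OF norm_triangle_ineq])
        (auto simp: norm_mult t_def intro!: mult_left_mono norm_triangle_ineq4)
    also have "\<dots> \<le> 1 + t * ((1 + t * (2 * K + K\<^sup>2)) * \<nu> + t * (K\<^sup>2 * (2 + K)))"
      using polar_pairsD(5)[OF f(1), of x] x Py diff t by (intro add_mono mult_left_mono) auto
    also have "\<dots> = 1 + t * \<nu> + C * t\<^sup>2" by (simp add: C_def power2_eq_square algebra_simps)
    finally show ?thesis by (simp add: y_def t_def)
  qed
  then show thesis by (intro that[of C]) (simp add: \<nu>_def)
qed

end


section \<open>Dual and bidual\<close>

text \<open>
  The dual is an abstract type with an evaluation map, so that the passage from a space to its dual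
  and from the dual to the bidual, over either scalar field, are instances of one locale.
\<close>

locale dual_space = primal: scalar_space sc + dual: scalar_space scd
  for sc :: "'k::real_normed_field \<Rightarrow> 'y::real_normed_vector \<Rightarrow> 'y"
    and scd :: "'k \<Rightarrow> 'd::real_normed_vector \<Rightarrow> 'd" +
  fixes ev :: "'d \<Rightarrow> 'y \<Rightarrow> 'k"
  assumes range_ev: "range ev = functionals sc"
    and norm_ev: "norm d = onorm (ev d)"
    and ev_add: "ev (d + e) y = ev d y + ev e y"
    and ev_sc: "ev (scd c d) y = c * ev d y"
begin

lemma ev_functional: "ev d \<in> functionals sc"
  using range_ev by blast

lemma ev_sc_right: "ev d (sc c y) = c * ev d y"
  by (rule functionals_sc[OF ev_functional])

lemma norm_ev_le: "norm (ev d y) \<le> norm d * norm y"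
  unfolding norm_ev by (rule functionals_bound[OF ev_functional])

lemma bounded_bilinear_ev: "bounded_bilinear ev"
proof
  fix d y and r :: real
  show "ev (r *\<^sub>R d) y = r *\<^sub>R ev d y"
    using ev_sc[of "of_real r" d y] by (simp add: dual.sc_of_real scaleR_conv_of_real)
  show "ev d (r *\<^sub>R y) = r *\<^sub>R ev d y"
    using ev_sc_right[of d "of_real r" y] by (simp add: primal.sc_of_real scaleR_conv_of_real)
  show "ev d (y + z) = ev d y + ev d z" for z
    by (rule linear_add[OF bounded_linear.linear[OF functionals_bounded_linear[OF ev_functional]]])
  show "\<exists>K. \<forall>a b. norm (ev a b) \<le> norm a * norm b * K"
    using norm_ev_le by (intro exI[of _ 1]) simp
qed (rule ev_add)

sublocale ev: bounded_bilinear ev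
  by (rule bounded_bilinear_ev)

lemma ev_eqI:
  assumes "\<And>y. ev d y = ev e y"
  shows "d = e"
proof -
  have "ev (d - e) = (\<lambda>_. 0)" by (rule ext) (simp add: ev.diff_left assms)
  then have "norm (d - e) = 0" by (simp add: norm_ev onorm_zero)
  then show ?thesis by simp
qed

lemma represent_functionals:
  assumes T: "\<And>p q. T p q \<in> functionals sc"
    and bound: "\<And>p q y. norm (T p q y) \<le> K * norm (p::'p::real_normed_vector) * norm (q::'q::real_normed_vector) * norm y"
    and K: "0 \<le> K"
  obtains M where "\<forall>p q y. ev (M p q) y = T p q y" "\<forall>p q. norm (M p q) \<le> K * norm p * norm q"
proof -
  have "\<exists>d. ev d = T p q" for p q
    using T[of p q] range_ev by (metis imageE)
  then obtain M where M: "\<And>p q. ev (M p q) = T p q" by metis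
  have "norm (M p q) \<le> K * norm p * norm q" for p q
    unfolding norm_ev M by (rule onorm_bound) (use K bound in auto)
  then show thesis by (intro that[of M]) (simp_all add: M)
qed

end

lemma limitin_weak_star:
  "limitin (weak_star ev) g w F \<longleftrightarrow> (\<forall>d. ((\<lambda>i. ev (g i) d) \<longlongrightarrow> ev w d) F)"
proof -
  have top: "topspace (weak_star ev) = UNIV"
    by (simp add: weak_star_def topspace_pullback_topology)
  have "limitin (weak_star ev) g w F \<longleftrightarrow>
      limitin (product_topology (\<lambda>_. euclidean) UNIV) (\<lambda>i. ev (g i)) (ev w) F"
    unfolding limitin_def top unfolding weak_star_def openin_pullback_topology
    by (auto simp: topspace_product_topology)
  also have "\<dots> \<longleftrightarrow> (\<forall>d. ((\<lambda>i. ev (g i) d) \<longlongrightarrow> ev w d) F)"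
    by (simp add: limitin_componentwise)
  finally show ?thesis .
qed

text \<open>
  Elements of the third dual occur only as functions in \<open>functionals sce\<close>, as in the
  definition of polar pairs.
\<close>

locale bidual_space =
  conjugation_space conj sc + X: dual_space sc scd evd + D: dual_space scd sce eve
  for conj :: "'k::{real_normed_field,euclidean_space} \<Rightarrow> 'k"
    and sc :: "'k \<Rightarrow> 'x::banach \<Rightarrow> 'x"
    and scd :: "'k \<Rightarrow> 'd::real_normed_vector \<Rightarrow> 'd"
    and evd :: "'d \<Rightarrow> 'x \<Rightarrow> 'k"
    and sce :: "'k \<Rightarrow> 'e::real_normed_vector \<Rightarrow> 'e"
    and eve :: "'e \<Rightarrow> 'd \<Rightarrow> 'k" +
  fixes J :: "'x \<Rightarrow> 'e"
  assumes eve_J: "eve (J x) d = evd d x"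
begin

text \<open>
  Goldstine's theorem for finitely many functionals, by least squares.  Let \<open>x\<close> nearly minimize, over
  the ball of radius \<open>R\<close>, the sum \<open>g x\<close> of the squared errors, and let \<open>\<psi>\<close> be the combination of
  the functionals whose coefficients are the conjugated errors at \<open>x\<close>.  Moving from \<open>x\<close> towards
  another point of the ball cannot lower \<open>g\<close> much, which says that \<open>x\<close> nearly maximizes the real part
  of \<open>\<psi>\<close>; hence \<open>R\<close> times the norm of \<open>\<psi>\<close> is at most about the real part of \<open>\<psi> x\<close>.  But the real
  part of \<open>u \<psi>\<close> exceeds that of \<open>\<psi> x\<close> by exactly \<open>g x\<close>, which contradicts \<open>norm u \<le> R\<close> unless the
  minimum is \<open>0\<close>.
\<close>

lemma goldstine_finite:
  assumes R: "0 < R" and u: "norm u \<le> R" and fin: "finite \<Phi>" and \<epsilon>: "0 < \<epsilon>"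
  shows "\<exists>x. norm x \<le> R \<and> (\<forall>d\<in>\<Phi>. norm (evd d x - eve u d) < \<epsilon>)"
proof (rule ccontr)
  assume contra: "\<not> ?thesis"
  define c where "c x d = eve u d - evd d x" for x d
  define g where "g x = (\<Sum>d\<in>\<Phi>. (norm (c x d))\<^sup>2)" for x
  define A where "A = cball (0::'x) R"
  have far: "\<epsilon>\<^sup>2 \<le> g x" if x: "x \<in> A" for x
  proof -
    obtain d where d: "d \<in> \<Phi>" "\<epsilon> \<le> norm (c x d)"
      using contra x unfolding A_def c_def by (auto simp: not_less norm_minus_commute)
    have "\<epsilon>\<^sup>2 \<le> (norm (c x d))\<^sup>2" using d(2) \<epsilon> by (intro power_mono) auto
    also have "\<dots> \<le> g x" unfolding g_def using fin d(1) by (intro member_le_sum) auto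
    finally show ?thesis .
  qed
  define m where "m = (INF x\<in>A. g x)"
  have A: "A \<noteq> {}" using R by (simp add: A_def)
  have m: "0 < m"
  proof -
    have "\<epsilon>\<^sup>2 \<le> m" unfolding m_def using A far by (intro cINF_greatest)
    then show ?thesis using \<epsilon> by (meson less_le_trans zero_less_power)
  qed
  have bdd: "bdd_below (g ` A)" using far by (intro bdd_belowI2)
  have mle: "m \<le> g x" if "x \<in> A" for x unfolding m_def by (rule cINF_lower[OF bdd that])
  define M where "M = (\<Sum>d\<in>\<Phi>. (norm d * (2 * R))\<^sup>2)"
  have M: "0 \<le> M" by (simp add: M_def sum_nonneg)
  \<comment> \<open>A step this short makes the quadratic term of the expansion of \<open>g\<close> harmless: \<open>s * M \<le> m / 2\<close>.\<close>
  define s where "s = min 1 (m / (2 * (M + 1)))"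
  have s: "0 < s" "s \<le> 1" using m M by (auto simp: s_def)
  have sM: "s * M \<le> m / 2"
  proof -
    have "s * M \<le> m / (2 * (M + 1)) * M" unfolding s_def using M by (intro mult_right_mono) auto
    also have "\<dots> \<le> m / 2" using m M by (simp add: field_simps)
    finally show ?thesis .
  qed
  obtain x where x: "x \<in> A" "g x < m + s * (m / 2)"
    using cInf_lessD[of "g ` A" "m + s * (m / 2)"] A m s unfolding m_def[symmetric] by auto
  have inner: "(\<Sum>d\<in>\<Phi>. c x d \<bullet> evd d y) \<le> (\<Sum>d\<in>\<Phi>. c x d \<bullet> evd d x) + m / 2" if y: "y \<in> A" for y
  proof -
    define z where "z = x + s *\<^sub>R (y - x)"
    have "z = (1 - s) *\<^sub>R x + s *\<^sub>R y" by (simp add: z_def algebra_simps)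
    then have "z \<in> A" using convexD[OF convex_cball[of "0::'x" R], of x y "1 - s" s] x(1) y s
      by (simp add: A_def)
    have nyx: "norm (y - x) \<le> 2 * R" using x(1) y norm_triangle_ineq4[of y x] by (simp add: A_def)
    have "g z = (\<Sum>d\<in>\<Phi>. (norm (c x d))\<^sup>2 - 2 * s * (c x d \<bullet> evd d (y - x)) + s\<^sup>2 * (norm (evd d (y - x)))\<^sup>2)"
      unfolding g_def
    proof (rule sum.cong[OF refl])
      fix d
      have c: "c z d = c x d - s *\<^sub>R evd d (y - x)"
        by (simp add: c_def z_def X.ev.add_right X.ev.scaleR_right)
      have "c z d \<bullet> c z d = c x d \<bullet> c x d - 2 * s * (c x d \<bullet> evd d (y - x)) + s\<^sup>2 * (evd d (y - x) \<bullet> evd d (y - x))"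
        unfolding c by (simp add: inner_diff_left inner_diff_right inner_commute power2_eq_square algebra_simps del: inner_eq_zero_iff)
      then show "(norm (c z d))\<^sup>2 = (norm (c x d))\<^sup>2 - 2 * s * (c x d \<bullet> evd d (y - x)) + s\<^sup>2 * (norm (evd d (y - x)))\<^sup>2"
        by (simp only: dot_square_norm)
    qed
    also have "\<dots> = g x - 2 * s * (\<Sum>d\<in>\<Phi>. c x d \<bullet> evd d (y - x)) + s\<^sup>2 * (\<Sum>d\<in>\<Phi>. (norm (evd d (y - x)))\<^sup>2)"
      by (simp add: g_def sum.distrib sum_subtractf sum_distrib_left)
    also have "\<dots> \<le> g x - 2 * s * (\<Sum>d\<in>\<Phi>. c x d \<bullet> evd d (y - x)) + s\<^sup>2 * M"
    proof -
      have "(norm (evd d (y - x)))\<^sup>2 \<le> (norm d * (2 * R))\<^sup>2" for d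
        using order_trans[OF X.norm_ev_le[of d "y - x"] mult_left_mono[OF nyx norm_ge_zero]]
        by (intro power_mono) auto
      then show ?thesis unfolding M_def by (intro add_left_mono mult_left_mono sum_mono) auto
    qed
    finally have "m \<le> m + s * (m / 2) - 2 * s * (\<Sum>d\<in>\<Phi>. c x d \<bullet> evd d (y - x)) + s * (s * M)"
      using mle[OF \<open>z \<in> A\<close>] x(2) by (simp add: power2_eq_square mult.assoc)
    then have "s * (2 * (\<Sum>d\<in>\<Phi>. c x d \<bullet> evd d (y - x))) \<le> s * (m / 2 + s * M)"
      by (simp add: algebra_simps)
    then have "2 * (\<Sum>d\<in>\<Phi>. c x d \<bullet> evd d (y - x)) \<le> m / 2 + s * M" using s by simp
    then show ?thesis using sM by (simp add: X.ev.diff_right inner_diff_right sum_subtractf)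
  qed
  define \<psi> where "\<psi> = (\<Sum>d\<in>\<Phi>. scd (conj (c x d)) d)"
  have ev\<psi>: "evd \<psi> y \<bullet> 1 = (\<Sum>d\<in>\<Phi>. c x d \<bullet> evd d y)" for y
    by (simp add: \<psi>_def X.ev.sum_left X.ev_sc inner_sum_left inner_conj[symmetric])
  have eve\<psi>: "eve u \<psi> \<bullet> 1 = (\<Sum>d\<in>\<Phi>. c x d \<bullet> eve u d)"
    by (simp add: \<psi>_def D.ev.sum_right D.ev_sc_right inner_sum_left inner_conj[symmetric])
  define T where "T = evd \<psi> x \<bullet> 1 + m / 2"
  have norm\<psi>: "norm (evd \<psi> y) \<le> T" if "y \<in> A" for y
  proof -
    obtain \<theta> where \<theta>: "norm \<theta> = 1" "\<theta> * evd \<psi> y = of_real (norm (evd \<psi> y))" by (rule norm_one_phase)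
    have "norm (evd \<psi> y) = of_real (norm (evd \<psi> y)) \<bullet> (1::'k)"
      by (simp add: of_real_def dot_square_norm)
    also have "\<dots> = evd \<psi> (sc \<theta> y) \<bullet> 1" by (simp add: \<theta>(2)[symmetric] X.ev_sc_right)
    also have "\<dots> \<le> T"
      using inner[of "sc \<theta> y"] that \<theta>(1) by (simp add: ev\<psi> T_def A_def norm_sc)
    finally show ?thesis .
  qed
  have T: "0 \<le> T" using norm\<psi>[OF x(1)] norm_ge_zero order_trans by blast
  have "norm \<psi> \<le> T / R"
    unfolding X.norm_ev
  proof (rule onorm_bound)
    fix y
    show "norm (evd \<psi> y) \<le> T / R * norm y"
    proof (cases "y = 0")
      case False
      have "norm (evd \<psi> ((R / norm y) *\<^sub>R y)) \<le> T" using R False by (intro norm\<psi>) (simp add: A_def)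
      then show ?thesis using R False by (simp add: X.ev.scaleR_right field_simps)
    qed (simp add: X.ev.zero_right)
  qed (use T R in auto)
  then have "norm u * norm \<psi> \<le> R * (T / R)" using u R by (intro mult_mono) auto
  then have "norm (eve u \<psi>) \<le> T" using D.norm_ev_le[of u \<psi>] R by simp
  then have "eve u \<psi> \<bullet> 1 \<le> T" using norm_cauchy_schwarz[of "eve u \<psi>" 1] by simp
  moreover have "g x = eve u \<psi> \<bullet> 1 - evd \<psi> x \<bullet> 1"
    unfolding g_def ev\<psi> eve\<psi> sum_subtractf[symmetric]
    by (rule sum.cong) (simp_all add: power2_norm_eq_inner inner_diff_right[symmetric] c_def)
  ultimately show False using mle[OF x(1)] m by (simp add: T_def)
qed

lemma goldstine:
  assumes R: "0 < R" and u: "norm u \<le> R"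
  obtains F where "F \<noteq> bot" "\<forall>\<^sub>F x in F. norm x \<le> R" "\<forall>d. ((\<lambda>x. evd d x) \<longlongrightarrow> eve u d) F"
proof -
  define I where "I = {(\<Phi>, \<epsilon>). finite (\<Phi>::'d set) \<and> (0::real) < \<epsilon>}"
  define S where "S = (\<lambda>(\<Phi>, \<epsilon>). {x. norm x \<le> R \<and> (\<forall>d\<in>\<Phi>. norm (evd d x - eve u d) < \<epsilon>)})"
  define F where "F = (INF i\<in>I. principal (S i))"
  have ev: "eventually P F \<longleftrightarrow> (\<exists>i\<in>I. \<forall>x\<in>S i. P x)" for P
    unfolding F_def
  proof (subst eventually_INF_base)
    have "({}, 1) \<in> I" by (simp add: I_def)
    then show "I \<noteq> {}" by blast
    fix i j assume "i \<in> I" "j \<in> I"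
    moreover obtain \<Phi> \<epsilon> \<Psi> \<delta> where "i = (\<Phi>, \<epsilon>)" "j = (\<Psi>, \<delta>)" by (cases i, cases j)
    ultimately show "\<exists>k\<in>I. principal (S k) \<le> inf (principal (S i)) (principal (S j))"
      by (intro bexI[of _ "(\<Phi> \<union> \<Psi>, min \<epsilon> \<delta>)"]) (auto simp: I_def S_def)
  qed (simp add: eventually_principal)
  have "F \<noteq> bot"
  proof -
    have "S i \<noteq> {}" if "i \<in> I" for i
      using that goldstine_finite[OF R u] by (auto simp: I_def S_def)
    then show ?thesis unfolding trivial_limit_def ev by blast
  qed
  moreover have "\<forall>\<^sub>F x in F. norm x \<le> R"
    unfolding ev by (rule bexI[of _ "({}, 1)"]) (auto simp: I_def S_def)
  moreover have "((\<lambda>x. evd d x) \<longlongrightarrow> eve u d) F" for d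
  proof (rule tendstoI)
    fix e :: real assume "0 < e"
    then show "\<forall>\<^sub>F x in F. dist (evd d x) (eve u d) < e"
      unfolding ev by (intro bexI[of _ "({d}, e)"]) (auto simp: I_def S_def dist_norm)
  qed
  ultimately show thesis using that by blast
qed


section \<open>The Arens extension\<close>

text \<open>
  The Arens extension is the third adjoint of \<open>B\<close>, and \<open>D1\<close>, \<open>D2\<close>, \<open>E\<close> are the three adjoints in turn.
  In these terms the inner limit is the weak-star convergence of \<open>y\<close> tested on \<open>D1 d x\<close>, and the
  outer limit is that of \<open>x\<close> tested on \<open>D2 v d\<close>; so the iterated limit exists for all nets.  Its
  uniqueness needs at least one pair of nets, which Goldstine's theorem provides.
\<close>

lemma arens_extension:
  assumes B: "B \<in> bilinear_maps sc"
  obtains D1 D2 E where "\<forall>d x y. evd (D1 d x) y = evd d (B x y)"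
    "\<forall>v d x. evd (D2 v d) x = eve v (D1 d x)"
    "\<forall>u v d. eve (E u v) d = eve u (D2 v d)"
    "E \<in> bilinear_maps sce" "\<forall>u v. arens eve J B u v = E u v"
proof -
  interpret B: bounded_bilinear B by (rule bilinear_maps_bounded_bilinear[OF B])
  obtain K where K: "0 < K" "\<And>x y. norm (B x y) \<le> norm x * norm y * K"
    using B.pos_bounded by blast
  have K0: "0 \<le> K" using K by simp
  have b1: "norm (evd d (B x y)) \<le> K * norm d * norm x * norm y" for d x y
    using order_trans[OF X.norm_ev_le mult_left_mono[OF K(2) norm_ge_zero], of d x y] by (simp add: mult_ac)
  have f1: "(\<lambda>y. evd d (B x y)) \<in> functionals sc" for d x
    by (rule functionalsI[OF _ _ b1])
      (simp_all add: B.add_right X.ev.add_right bilinear_maps_sc_right[OF B] X.ev_sc_right)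
  obtain D1 where D1: "\<forall>d x y. evd (D1 d x) y = evd d (B x y)"
      and D1n: "\<forall>d x. norm (D1 d x) \<le> K * norm d * norm x"
    by (rule X.represent_functionals[where T="\<lambda>d x y. evd d (B x y)", OF f1 b1 K0])
  have D1_simps: "D1 d (x + x') = D1 d x + D1 d x'" "D1 (d + d') x = D1 d x + D1 d' x"
    "D1 d (sc c x) = scd c (D1 d x)" "D1 (scd c d) x = scd c (D1 d x)" for d d' x x' c
    by (rule X.ev_eqI; simp add: D1 B.add_left X.ev.add_right X.ev_add X.ev_sc
        bilinear_maps_sc_left[OF B] X.ev_sc_right)+
  have b2: "norm (eve v (D1 d x)) \<le> K * norm v * norm d * norm x" for v d x
    using order_trans[OF D.norm_ev_le mult_left_mono[OF spec[OF spec[OF D1n]] norm_ge_zero], of v d x]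
    by (simp add: mult_ac)
  have f2: "(\<lambda>x. eve v (D1 d x)) \<in> functionals sc" for v d
    by (rule functionalsI[OF _ _ b2]) (simp_all add: D1_simps D.ev.add_right D.ev_sc_right)
  obtain D2 where D2: "\<forall>v d x. evd (D2 v d) x = eve v (D1 d x)"
      and D2n: "\<forall>v d. norm (D2 v d) \<le> K * norm v * norm d"
    by (rule X.represent_functionals[where T="\<lambda>v d x. eve v (D1 d x)", OF f2 b2 K0])
  have D2_simps: "D2 v (d + d') = D2 v d + D2 v d'" "D2 (v + v') d = D2 v d + D2 v' d"
    "D2 v (scd c d) = scd c (D2 v d)" "D2 (sce c v) d = scd c (D2 v d)" for v v' d d' c
    by (rule X.ev_eqI; simp add: D2 D1_simps D.ev.add_right D.ev_add X.ev_add X.ev_sc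
        D.ev_sc D.ev_sc_right)+
  have b3: "norm (eve u (D2 v d)) \<le> K * norm u * norm v * norm d" for u v d
    using order_trans[OF D.norm_ev_le mult_left_mono[OF spec[OF spec[OF D2n]] norm_ge_zero], of u v d]
    by (simp add: mult_ac)
  have f3: "(\<lambda>d. eve u (D2 v d)) \<in> functionals scd" for u v
    by (rule X.dual.functionalsI[OF _ _ b3]) (simp_all add: D2_simps D.ev.add_right D.ev_sc_right)
  obtain E where E: "\<forall>u v d. eve (E u v) d = eve u (D2 v d)"
      and En: "\<forall>u v. norm (E u v) \<le> K * norm u * norm v"
    by (rule D.represent_functionals[where T="\<lambda>u v d. eve u (D2 v d)", OF f3 b3 K0])
  have E_bil: "E \<in> bilinear_maps sce"
  proof (rule D.dual.bilinear_mapsI)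
    show "norm (E u v) \<le> K * norm u * norm v" for u v using En by blast
  qed (rule D.ev_eqI; simp add: E D2_simps D.ev_add D.ev_sc D.ev.add_right D.ev_sc_right)+
  have inner_lim: "eve (J (B x y)) d = eve (J y) (D1 d x)" for x y d
    by (simp add: eve_J D1)
  have outer_lim: "eve (E (J x) v) d = eve (J x) (D2 v d)" for x v d
    by (simp add: E)
  have J_E: "eve (E (J x) v) d = eve v (D1 d x)" for x v d
    by (simp add: E eve_J D2)
  have "arens eve J B u v = E u v" for u v
    unfolding arens_def limitin_weak_star
  proof (rule the_equality)
    show "\<forall>F G. F \<noteq> bot \<and> G \<noteq> bot \<and> (\<forall>d. ((\<lambda>i. eve (J i) d) \<longlongrightarrow> eve u d) F) \<and>
        (\<forall>d. ((\<lambda>i. eve (J i) d) \<longlongrightarrow> eve v d) G) \<longrightarrow>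
      (\<exists>h. (\<forall>x d. ((\<lambda>i. eve (J (B x i)) d) \<longlongrightarrow> eve (h x) d) G) \<and>
        (\<forall>d. ((\<lambda>i. eve (h i) d) \<longlongrightarrow> eve (E u v) d) F))"
    proof (intro allI impI, elim conjE)
      fix F G
      assume F: "\<forall>d. ((\<lambda>i. eve (J i) d) \<longlongrightarrow> eve u d) F"
        and G: "\<forall>d. ((\<lambda>i. eve (J i) d) \<longlongrightarrow> eve v d) G"
      show "\<exists>h. (\<forall>x d. ((\<lambda>i. eve (J (B x i)) d) \<longlongrightarrow> eve (h x) d) G) \<and>
        (\<forall>d. ((\<lambda>i. eve (h i) d) \<longlongrightarrow> eve (E u v) d) F)"
      proof (intro exI[of _ "\<lambda>x. E (J x) v"] conjI allI)
        show "((\<lambda>i. eve (J (B x i)) d) \<longlongrightarrow> eve (E (J x) v) d) G" for x d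
          using G unfolding inner_lim J_E by blast
        show "((\<lambda>i. eve (E (J i) v) d) \<longlongrightarrow> eve (E u v) d) F" for d
          using F unfolding outer_lim E[rule_format, of u v d] by blast
      qed
    qed
  next
    fix w
    assume w: "\<forall>F G. F \<noteq> bot \<and> G \<noteq> bot \<and> (\<forall>d. ((\<lambda>i. eve (J i) d) \<longlongrightarrow> eve u d) F) \<and>
        (\<forall>d. ((\<lambda>i. eve (J i) d) \<longlongrightarrow> eve v d) G) \<longrightarrow>
      (\<exists>h. (\<forall>x d. ((\<lambda>i. eve (J (B x i)) d) \<longlongrightarrow> eve (h x) d) G) \<and>
        (\<forall>d. ((\<lambda>i. eve (h i) d) \<longlongrightarrow> eve w d) F))"
    have pos: "0 < norm z + 1" "norm z \<le> norm z + 1" for z :: 'e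
      by (simp_all add: add_nonneg_pos)
    obtain F where F: "F \<noteq> bot" "\<forall>d. ((\<lambda>x. evd d x) \<longlongrightarrow> eve u d) F"
      by (rule goldstine[OF pos, of u])
    obtain G where G: "G \<noteq> bot" "\<forall>d. ((\<lambda>x. evd d x) \<longlongrightarrow> eve v d) G"
      by (rule goldstine[OF pos, of v])
    have "\<exists>h. (\<forall>x d. ((\<lambda>i. eve (J (B x i)) d) \<longlongrightarrow> eve (h x) d) G) \<and>
        (\<forall>d. ((\<lambda>i. eve (h i) d) \<longlongrightarrow> eve w d) F)"
      using F G by (intro w[rule_format]) (simp add: eve_J)
    then obtain h where h1: "\<forall>x d. ((\<lambda>i. eve (J (B x i)) d) \<longlongrightarrow> eve (h x) d) G"
      and h2: "\<forall>d. ((\<lambda>i. eve (h i) d) \<longlongrightarrow> eve w d) F" by blast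
    have h: "eve (h x) d = eve (J x) (D2 v d)" for x d
    proof (rule tendsto_unique[OF G(1) h1[rule_format]])
      show "((\<lambda>i. eve (J (B x i)) d) \<longlongrightarrow> eve (J x) (D2 v d)) G"
        using G(2)[rule_format, of "D1 d x"] 
        by (simp add: eve_J D1[rule_format, symmetric] D2)
    qed
    show "w = E u v"
    proof (rule D.ev_eqI, rule tendsto_unique[OF F(1) h2[rule_format]])
      show "((\<lambda>i. eve (h i) d) \<longlongrightarrow> eve (E u v) d) F" for d
        using F(2) unfolding h eve_J E[rule_format, of u v d] by blast
    qed
  qed
  with D1 D2 E E_bil show thesis using that by blast
qed

end


section \<open>The Aron-Berner extension\<close>

context bidual_space
begin

lemma aron_berner_poly2:
  assumes "P \<in> poly2 sc"
  shows "aron_berner sc eve J P \<in> poly2 sce"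
proof -
  obtain D1 D2 E where "E \<in> bilinear_maps sce" "\<forall>u v. arens eve J (symmetric_bilinear sc P) u v = E u v"
    by (rule arens_extension[OF symmetric_bilinear_properties(1)[OF assms]])
  then show ?thesis by (auto simp: poly2_def aron_berner_def)
qed

text \<open>
  Let \<open>i\<close> and \<open>j\<close> be far along the net.  Then \<open>x i - x j\<close> is weakly small, so that by weak uniform
  continuity \<open>P (x i - x j)\<close> is close to \<open>P 0 = 0\<close>, and \<open>P (x i + x j)\<close> is close to
  \<open>P (2 x i) = 4 P (x i)\<close>.  By polarization \<open>B (x i) (x j)\<close> is then close to \<open>P (x i)\<close>.  So the
  iterated limit that defines the extension is a limit along the diagonal, and as \<open>P (x i)\<close> is a
  Cauchy net in norm, its limit lies in the space itself.
\<close>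

lemma aron_berner_limit:
  fixes x :: "'i \<Rightarrow> 'x"
  assumes P: "P \<in> poly2_wu sc" and F: "F \<noteq> bot" and R: "\<forall>\<^sub>F i in F. norm (x i) \<le> R"
    and lim: "\<And>d. ((\<lambda>i. evd d (x i)) \<longlongrightarrow> eve u d) F"
  obtains p where "((\<lambda>i. P (x i)) \<longlongrightarrow> p) F" "aron_berner sc eve J P u = J p"
proof -
  have P2: "P \<in> poly2 sc" by (rule poly2_wuD[OF P])
  define B where "B = symmetric_bilinear sc P"
  have B: "B \<in> bilinear_maps sc" "\<And>x y. B x y = B y x" "\<And>x. P x = B x x"
    unfolding B_def by (rule symmetric_bilinear_properties[OF P2])+
  have small: "\<exists>S. eventually S F \<and> (\<forall>i j. S i \<and> S j \<longrightarrow>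
      norm (P (x i) - P (x j)) < \<epsilon> \<and> norm (B (x i) (x j) - P (x i)) < \<epsilon>)" if \<epsilon>: "0 < \<epsilon>" for \<epsilon> :: real
  proof -
    \<comment> \<open>The ball of radius \<open>2 * R\<close> contains the sums and differences that polarization uses.\<close>
    obtain \<Phi> \<eta> where \<Phi>: "finite \<Phi>" "\<Phi> \<subseteq> functionals sc" and \<eta>: "0 < \<eta>"
      and wu: "\<forall>v\<in>cball 0 (2 * R). \<forall>w\<in>cball 0 (2 * R).
        (\<forall>\<phi>\<in>\<Phi>. norm (\<phi> (v - w)) < \<eta>) \<longrightarrow> norm (P v - P w) < \<epsilon>"
      by (rule poly2_wu_continuity[OF P bounded_cball \<epsilon>])
    have "\<exists>l. ((\<lambda>i. \<phi> (x i)) \<longlongrightarrow> l) F" if "\<phi> \<in> \<Phi>" for \<phi>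
    proof -
      have "\<phi> \<in> range evd" unfolding X.range_ev by (rule subsetD[OF \<Phi>(2) that])
      then obtain d where d: "\<phi> = evd d" by (rule rangeE)
      show ?thesis unfolding d by (rule exI, rule lim)
    qed
    then have "\<forall>\<phi>\<in>\<Phi>. \<exists>l. ((\<lambda>i. \<phi> (x i)) \<longlongrightarrow> l) F" by (rule ballI)
    from bchoice[OF this] obtain l where l: "\<forall>\<phi>\<in>\<Phi>. ((\<lambda>i. \<phi> (x i)) \<longlongrightarrow> l \<phi>) F" by (rule exE)
    define S where "S i \<longleftrightarrow> norm (x i) \<le> R \<and> (\<forall>\<phi>\<in>\<Phi>. dist (\<phi> (x i)) (l \<phi>) < \<eta> / 2)" for i
    have "\<forall>\<^sub>F i in F. \<forall>\<phi>\<in>\<Phi>. dist (\<phi> (x i)) (l \<phi>) < \<eta> / 2"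
      using \<Phi>(1) \<eta> by (intro eventually_ball_finite ballI tendstoD[OF l[rule_format]]) auto
    then have "eventually S F" unfolding S_def using R by (rule eventually_conj[rotated])
    moreover have "norm (P (x i) - P (x j)) < \<epsilon> \<and> norm (B (x i) (x j) - P (x i)) < \<epsilon>"
      if S: "S i" "S j" for i j
    proof -
      have close: "norm (\<phi> (x i - x j)) < \<eta>" "norm (\<phi> (x j - x i)) < \<eta>" if "\<phi> \<in> \<Phi>" for \<phi>
      proof -
        interpret \<phi>: bounded_linear \<phi>
          by (rule functionals_bounded_linear[OF subsetD[OF \<Phi>(2) that]])
        have "dist (\<phi> (x i)) (\<phi> (x j)) < \<eta>"
          by (rule dist_triangle_half_l[of _ "l \<phi>"]) (use S that in \<open>auto simp: S_def\<close>)
        then show "norm (\<phi> (x i - x j)) < \<eta>" "norm (\<phi> (x j - x i)) < \<eta>"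
          by (simp_all add: \<phi>.diff dist_norm norm_minus_commute)
      qed
      have R: "norm (x i) \<le> R" "norm (x j) \<le> R" using S by (simp_all add: S_def)
      have R0: "0 \<le> R" by (rule order_trans[OF norm_ge_zero R(1)])
      have wu': "norm (P v - P w) < \<epsilon>"
        if "norm v \<le> 2 * R" "norm w \<le> 2 * R" "v - w = x i - x j \<or> v - w = x j - x i" for v w
      proof -
        have "\<forall>\<phi>\<in>\<Phi>. norm (\<phi> (v - w)) < \<eta>" using close that(3) by auto
        then show ?thesis using bspec[OF bspec[OF wu, of v], of w] that by simp
      qed
      have "norm (P (x i) - P (x j)) < \<epsilon>"
        by (rule wu') (use R R0 in auto)
      moreover have "norm (B (x i) (x j) - P (x i)) < \<epsilon>"
      proof -
        have 1: "norm (P (x i + x j) - P (2 *\<^sub>R x i)) < \<epsilon>"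
          by (rule wu') (use R norm_triangle_ineq[of "x i" "x j"] in \<open>auto simp: scaleR_2 intro: order_trans[OF norm_triangle_ineq]\<close>)
        have 2: "norm (P (x i - x j) - P 0) < \<epsilon>"
          by (rule wu') (use R R0 norm_triangle_ineq4[of "x i" "x j"] in auto)
        have "B (x i) (x j) - P (x i) = (1/4) *\<^sub>R ((P (x i + x j) - P (2 *\<^sub>R x i)) - (P (x i - x j) - P 0))"
          using symmetric_polarization[OF bilinear_maps_bounded_bilinear[OF B(1)] B(2), of "x i" "x j"]
          by (simp add: B(3)[symmetric] poly2_zero[OF P2] poly2_scaleR[OF P2] scaleR_diff_right)
        then have "norm (B (x i) (x j) - P (x i)) = (1/4) * norm ((P (x i + x j) - P (2 *\<^sub>R x i)) - (P (x i - x j) - P 0))"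
          by simp
        also have "\<dots> < \<epsilon>"
          using norm_triangle_ineq4[of "P (x i + x j) - P (2 *\<^sub>R x i)" "P (x i - x j) - P 0"] 1 2 \<epsilon> by simp
        finally show ?thesis .
      qed
      ultimately show ?thesis by blast
    qed
    ultimately show ?thesis by blast
  qed
  \<comment> \<open>The first estimate gives norm convergence, the second identifies the limit.\<close>
  have "cauchy_filter (filtermap (\<lambda>i. P (x i)) F)"
    unfolding cauchy_filter_metric_filtermap
  proof (intro allI impI)
    fix e :: real assume "0 < e"
    from small[OF this] obtain S where "eventually S F"
      "\<forall>i j. S i \<and> S j \<longrightarrow> norm (P (x i) - P (x j)) < e" by blast
    then show "\<exists>S. eventually S F \<and> (\<forall>i j. S i \<and> S j \<longrightarrow> dist (P (x i)) (P (x j)) < e)"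
      by (auto simp: dist_norm)
  qed
  moreover have "filtermap (\<lambda>i. P (x i)) F \<noteq> bot" using F by (simp add: filtermap_bot_iff)
  moreover have "filtermap (\<lambda>i. P (x i)) F \<le> principal UNIV" by simp
  ultimately have "\<exists>p\<in>UNIV. filtermap (\<lambda>i. P (x i)) F \<le> nhds p"
    using complete_UNIV unfolding complete_uniform by blast
  then obtain p where p: "((\<lambda>i. P (x i)) \<longlongrightarrow> p) F" unfolding filterlim_def by blast
  obtain D1 D2 E where D1: "\<forall>d x y. evd (D1 d x) y = evd d (B x y)"
    and D2: "\<forall>v d x. evd (D2 v d) x = eve v (D1 d x)"
    and E: "\<forall>u v d. eve (E u v) d = eve u (D2 v d)" "\<forall>u v. arens eve J B u v = E u v"
    by (rule arens_extension[OF B(1)])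
  have "eve (E u u) d = evd d p" for d
  proof -
    have "norm (eve u (D2 u d) - evd d p) \<le> \<epsilon> * norm d" if \<epsilon>: "0 < \<epsilon>" for \<epsilon>
    proof -
      obtain S where S: "eventually S F" "\<forall>i j. S i \<and> S j \<longrightarrow> norm (B (x i) (x j) - P (x i)) < \<epsilon>"
        using small[OF \<epsilon>] by blast
      have "norm (evd (D2 u d) (x i) - evd d (P (x i))) \<le> \<epsilon> * norm d" if "S i" for i
      proof (rule tendsto_upperbound[OF _ _ F])
        show "((\<lambda>j. norm (evd d (B (x i) (x j)) - evd d (P (x i)))) \<longlongrightarrow>
            norm (evd (D2 u d) (x i) - evd d (P (x i)))) F"
          using lim[of "D1 d (x i)"] D1 D2 by (intro tendsto_intros) simp
        show "\<forall>\<^sub>F j in F. norm (evd d (B (x i) (x j)) - evd d (P (x i))) \<le> \<epsilon> * norm d"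
          using S(1)
        proof eventually_elim
          case (elim j)
          then have "norm (B (x i) (x j) - P (x i)) \<le> \<epsilon>" using S(2) that by (simp add: less_imp_le)
          then have "norm d * norm (B (x i) (x j) - P (x i)) \<le> norm d * \<epsilon>" by (rule mult_left_mono) simp
          then show ?case
            using X.norm_ev_le[of d "B (x i) (x j) - P (x i)"] by (simp add: X.ev.diff_right mult.commute)
        qed
      qed
      then have "\<forall>\<^sub>F i in F. norm (evd (D2 u d) (x i) - evd d (P (x i))) \<le> \<epsilon> * norm d"
        using S(1) by (rule eventually_mono[rotated])
      moreover have "((\<lambda>i. norm (evd (D2 u d) (x i) - evd d (P (x i)))) \<longlongrightarrow>
          norm (eve u (D2 u d) - evd d p)) F"
        by (intro tendsto_intros lim X.ev.tendsto p)
      ultimately show ?thesis by (intro tendsto_upperbound[OF _ _ F])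
    qed
    note le = this
    have "norm (eve u (D2 u d) - evd d p) \<le> 0 + e" if e: "0 < e" for e
    proof -
      have "e / (norm d + 1) * norm d \<le> e / (norm d + 1) * (norm d + 1)"
        using e by (intro mult_left_mono) (simp_all add: add_nonneg_pos)
      also have "\<dots> = e" using add_nonneg_pos[OF norm_ge_zero[of d] zero_less_one] by simp
      finally have "e / (norm d + 1) * norm d \<le> e" .
      with le[of "e / (norm d + 1)"] e show ?thesis by (simp add: add_nonneg_pos)
    qed
    then have "norm (eve u (D2 u d) - evd d p) \<le> 0" by (rule field_le_epsilon)
    then show ?thesis by (simp add: E)
  qed
  then have "E u u = J p" by (intro D.ev_eqI) (simp add: eve_J)
  then have "aron_berner sc eve J P u = J p"
    using E(2) by (simp add: aron_berner_def B_def)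
  with p show thesis by (rule that)
qed

text \<open>
  If \<open>f u = 1\<close> and the phase of \<open>c\<close> is chosen well, then \<open>1 + |c| |f (AB(P) u)|\<close> is at most
  \<open>\<parallel>u + c AB(P) u\<parallel>\<close>.  The norm of a weak-star limit of the points \<open>x + c P(x)\<close> obeys the same bound
  as these points, namely that of Lumer's formula.  Comparing the terms of first order in \<open>c\<close> gives
  the claim.
\<close>

lemma aron_berner_numerical_range_le:
  assumes P: "P \<in> poly2_wu sc" and ne: "polar_pairs sc \<noteq> {}" and uf: "(u, f) \<in> polar_pairs sce"
  shows "norm (f (aron_berner sc eve J P u)) \<le> num_radius sc P"
proof -
  note P2 = poly2_wuD[OF P]
  define \<nu> where "\<nu> = num_radius sc P"
  obtain C where C: "\<forall>c x. norm c \<le> 1 \<longrightarrow> norm x \<le> 1 \<longrightarrow>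
    norm (x + sc c (P x)) \<le> 1 + norm c * num_radius sc P + C * (norm c)\<^sup>2"
    by (rule norm_perturbation_le_num_radius[OF P2 ne])
  note uf' = polar_pairsD[OF uf]
  interpret f: bounded_linear f by (rule functionals_bounded_linear[OF uf'(2)])
  obtain F where F: "F \<noteq> bot" "\<forall>\<^sub>F x in F. norm x \<le> 1" "\<forall>d. ((\<lambda>x. evd d x) \<longlongrightarrow> eve u d) F"
    by (rule goldstine[OF zero_less_one, of u]) (use uf'(1) in auto)
  obtain p where p: "((\<lambda>x. P x) \<longlongrightarrow> p) F" "aron_berner sc eve J P u = J p"
    by (rule aron_berner_limit[OF P F(1,2) F(3)[rule_format]])
  define v where "v = norm (f (J p))"
  have main: "v \<le> \<nu> + C * t" if t: "0 < t" "t \<le> 1" for t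
  proof -
    obtain \<theta> where \<theta>: "norm \<theta> = 1" "\<theta> * f (J p) = of_real v" unfolding v_def by (rule norm_one_phase)
    define c where "c = of_real t * \<theta>"
    have c: "norm c = t" using \<theta>(1) t by (simp add: c_def norm_mult)
    define M where "M = 1 + t * \<nu> + C * t\<^sup>2"
    have "norm (eve (u + sce c (J p)) d) \<le> M * norm d" for d
    proof (rule tendsto_upperbound[OF _ _ F(1)])
      show "((\<lambda>x. norm (evd d (x + sc c (P x)))) \<longlongrightarrow> norm (eve (u + sce c (J p)) d)) F"
        unfolding X.ev.add_right X.ev_sc_right D.ev.add_left D.ev_sc eve_J
        by (intro tendsto_intros X.ev.tendsto p F(3)[rule_format])
      show "\<forall>\<^sub>F x in F. norm (evd d (x + sc c (P x))) \<le> M * norm d"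
        using F(2)
      proof eventually_elim
        case (elim x)
        have "norm (x + sc c (P x)) \<le> M"
          using C[rule_format, of c x] c t elim by (simp add: M_def \<nu>_def)
        then have "norm d * norm (x + sc c (P x)) \<le> norm d * M" by (rule mult_left_mono) simp
        then show ?case using X.norm_ev_le[of d "x + sc c (P x)"] by (simp add: mult.commute)
      qed
    qed
    moreover have "0 \<le> M"
      using order_trans[OF norm_ge_zero C[rule_format, of c 0]] c t by (simp add: M_def \<nu>_def)
    ultimately have "norm (u + sce c (J p)) \<le> M" unfolding D.norm_ev by (intro onorm_bound) auto
    moreover have "f (u + sce c (J p)) = of_real (1 + t * v)"
      using \<theta>(2) uf'(4) by (simp add: f.add functionals_sc[OF uf'(2)] c_def mult.assoc)
    then have "norm (f (u + sce c (J p))) = \<bar>1 + t * v\<bar>" by (simp only: norm_of_real)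
    then have "1 + t * v \<le> norm (u + sce c (J p))"
      using uf'(5)[of "u + sce c (J p)"] by linarith
    ultimately have "t * v \<le> t * (\<nu> + C * t)" by (simp add: M_def power2_eq_square algebra_simps)
    then show ?thesis using t by simp
  qed
  have "v \<le> \<nu>"
  proof (rule field_le_epsilon)
    fix e :: real assume e: "0 < e"
    define t where "t = min 1 (e / (\<bar>C\<bar> + 1))"
    have t: "0 < t" "t \<le> 1" using e by (auto simp: t_def add_nonneg_pos)
    have "C * t \<le> \<bar>C\<bar> * (e / (\<bar>C\<bar> + 1))"
      using t by (intro mult_mono) (auto simp: t_def)
    also have "\<dots> \<le> e" using e by (simp add: field_simps)
    finally show "v \<le> \<nu> + e" using main[OF t] by simp
  qed
  then show ?thesis by (simp add: v_def p(2) \<nu>_def)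
qed

end


section \<open>Attainment at weak-star cluster points\<close>

text \<open>
  Tychonoff's theorem, in the form in which it yields weak-star cluster points: passing to a finer
  filter plays the role of passing to a subnet.
\<close>

lemma pointwise_bounded_cluster:
  fixes g :: "'i \<Rightarrow> 'd \<Rightarrow> 'k::{real_normed_vector,heine_borel}"
  assumes F: "F \<noteq> bot" and g: "\<And>i d. norm (g i d) \<le> r d"
  obtains G l where "G \<noteq> bot" "G \<le> F" "\<forall>d. ((\<lambda>i. g i d) \<longlongrightarrow> l d) G"
proof -
  define S where "S = PiE UNIV (\<lambda>d. cball 0 (r d) :: 'k set)"
  have "compactin (product_topology (\<lambda>_. euclidean) UNIV) S"
    unfolding S_def compactin_PiE by simp
  then have "compact S" by (simp add: euclidean_product_topology)
  moreover have "filtermap g F \<noteq> bot" using F by (simp add: filtermap_bot_iff)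
  moreover have "eventually (\<lambda>h. h \<in> S) (filtermap g F)"
    using g by (simp add: eventually_filtermap S_def PiE_UNIV_domain)
  ultimately obtain l where l: "inf (nhds l) (filtermap g F) \<noteq> bot"
    unfolding compact_filter by blast
  define G where "G = inf F (filtercomap g (nhds l))"
  have "G \<noteq> bot"
  proof
    assume "G = bot"
    then have "eventually (\<lambda>_. False) G" by simp
    then obtain P Q where "eventually P F" "eventually Q (nhds l)" "\<And>i. P i \<Longrightarrow> \<not> Q (g i)"
      unfolding G_def eventually_inf eventually_filtercomap by blast
    then have "eventually (\<lambda>h. \<not> Q h) (filtermap g F)"
      by (auto simp: eventually_filtermap elim: eventually_mono)
    with \<open>eventually Q (nhds l)\<close> have "eventually (\<lambda>_. False) (inf (nhds l) (filtermap g F))"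
      unfolding eventually_inf by blast
    with l show False by (simp add: trivial_limit_def)
  qed
  moreover have "((\<lambda>i. g i d) \<longlongrightarrow> l d) G" for d
  proof -
    have "(g \<longlongrightarrow> l) G"
      unfolding G_def by (rule filterlim_mono[OF filterlim_filtercomap order_refl inf_le2])
    then have "limitin (product_topology (\<lambda>_. euclidean) UNIV) g l G"
      by (simp add: euclidean_product_topology)
    then show ?thesis by (simp add: limitin_componentwise)
  qed
  ultimately show thesis using that[of G l] by (simp add: G_def)
qed

context bidual_space
begin

text \<open>
  The maximum is found at cluster points: \<open>u\<close> of the \<open>x m\<close> along \<open>G\<close>, and then \<open>h\<close> of the \<open>f n\<close> along
  the finer filter \<open>H\<close>.  Neither \<open>u\<close> nor \<open>h\<close> need have norm \<open>1\<close> for a general sequence of polar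
  pairs, let alone satisfy \<open>|h u| = 1\<close>.  It is the condition on \<open>f n (x m)\<close> that ensures this: the
  limit in \<open>m\<close> gives \<open>|u (f n)| \<ge> 1 - \<delta> n\<close>, and then the limit in \<open>n\<close> gives \<open>|h u| \<ge> 1\<close>.
\<close>

lemma aron_berner_attains:
  fixes x :: "nat \<Rightarrow> 'x" and f :: "nat \<Rightarrow> 'x \<Rightarrow> 'k"
  assumes P: "P \<in> poly2_wu sc" and xf: "\<And>n. (x n, f n) \<in> polar_pairs sc"
    and max: "(\<lambda>n. norm (f n (P (x n)))) \<longlonglongrightarrow> num_radius sc P"
    and \<delta>: "\<delta> \<longlonglongrightarrow> 0" and norming: "\<And>m n. n < m \<Longrightarrow> 1 - \<delta> n \<le> norm (f n (x m))"
  shows "aron_berner sc eve J P \<in> NRA2 sce"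
proof -
  note xf' = polar_pairsD[OF xf]
  have ne: "polar_pairs sc \<noteq> {}" using xf by auto
  have "\<exists>d. evd d = f n" for n using xf'(2) X.range_ev by (metis imageE)
  then obtain \<phi> where \<phi>: "\<And>n. evd (\<phi> n) = f n" by metis
  have \<phi>1: "norm (\<phi> n) = 1" for n unfolding X.norm_ev \<phi> by (rule xf'(3))
  obtain G g where G: "G \<noteq> bot" "G \<le> sequentially" and g: "\<forall>d. ((\<lambda>n. evd d (x n)) \<longlongrightarrow> g d) G"
    by (rule pointwise_bounded_cluster[of sequentially "\<lambda>n d. evd d (x n)" norm])
      (use X.norm_ev_le[of _ "x _"] xf'(1) in auto)
  have g_le: "norm (g d) \<le> 1 * norm d" for d
    by (rule tendsto_upperbound[OF tendsto_norm[OF g[rule_format, of d]] _ G(1)])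
      (use X.norm_ev_le[of d "x _"] xf'(1) in auto)
  have "g \<in> functionals scd"
  proof (rule X.dual.functionalsI[OF _ _ g_le])
    fix c d d'
    show "g (d + d') = g d + g d'"
      by (rule tendsto_unique[OF G(1) g[rule_format]]) (simp add: X.ev_add tendsto_add g)
    show "g (scd c d) = c * g d"
      by (rule tendsto_unique[OF G(1) g[rule_format]]) (simp add: X.ev_sc tendsto_mult g)
  qed
  then obtain u where u: "eve u = g" using D.range_ev by (metis imageE)
  have u1: "norm u \<le> 1" unfolding D.norm_ev u by (rule onorm_bound) (use g_le in auto)
  obtain p where p: "((\<lambda>n. P (x n)) \<longlongrightarrow> p) G" "aron_berner sc eve J P u = J p"
    by (rule aron_berner_limit[OF P G(1), of x 1 u]) (use xf'(1) g u in auto)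
  obtain H h where H: "H \<noteq> bot" "H \<le> G" and h: "\<forall>w. ((\<lambda>n. eve w (\<phi> n)) \<longlongrightarrow> h w) H"
    by (rule pointwise_bounded_cluster[of G "\<lambda>n w. eve w (\<phi> n)" norm])
      (use D.norm_ev_le[of _ "\<phi> _"] \<phi>1 G(1) in auto)
  have h_le: "norm (h w) \<le> 1 * norm w" for w
    by (rule tendsto_upperbound[OF tendsto_norm[OF h[rule_format, of w]] _ H(1)])
      (use D.norm_ev_le[of w "\<phi> _"] \<phi>1 in auto)
  have hf: "h \<in> functionals sce"
  proof (rule D.dual.functionalsI[OF _ _ h_le])
    fix c w w'
    show "h (w + w') = h w + h w'"
      by (rule tendsto_unique[OF H(1) h[rule_format]]) (simp add: D.ev_add tendsto_add h)
    show "h (sce c w) = c * h w"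
      by (rule tendsto_unique[OF H(1) h[rule_format]]) (simp add: D.ev_sc tendsto_mult h)
  qed
  have H_seq: "H \<le> sequentially" using H(2) G(2) by (rule order_trans)
  have "1 - \<delta> n \<le> norm (eve u (\<phi> n))" for n
    unfolding u
  proof (rule tendsto_lowerbound[OF tendsto_norm[OF g[rule_format, of "\<phi> n"]] _ G(1)])
    have "\<forall>\<^sub>F m in sequentially. 1 - \<delta> n \<le> norm (evd (\<phi> n) (x m))"
      unfolding \<phi> using norming by (auto simp: eventually_sequentially intro!: exI[of _ "Suc n"])
    then show "\<forall>\<^sub>F m in G. 1 - \<delta> n \<le> norm (evd (\<phi> n) (x m))" by (rule filter_leD[OF G(2)])
  qed
  then have "1 - 0 \<le> norm (h u)"
    by (intro tendsto_le[OF H(1) tendsto_norm[OF h[rule_format, of u]] tendsto_diff[OF tendsto_const filterlim_mono[OF \<delta> order_refl H_seq]]])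
      simp
  then have hu: "1 \<le> norm (h u)" by simp
  with h_le[of u] u1 have hu1: "norm (h u) = 1" and nu: "norm u = 1" by simp_all
  define k where "k w = inverse (h u) * h w" for w
  have k_le: "norm (k w) \<le> 1 * norm w" for w
    using h_le[of w] hu1 by (simp add: k_def norm_mult norm_inverse)
  have h_bl: "bounded_linear h" by (rule functionals_bounded_linear[OF hf])
  have k: "k \<in> functionals sce"
    by (rule D.dual.functionalsI[OF _ _ k_le])
      (simp_all add: k_def linear_add[OF bounded_linear.linear[OF h_bl]] functionals_sc[OF hf] algebra_simps)
  have ku: "k u = 1" using hu1 by (cases "h u = 0") (simp_all add: k_def)
  have "onorm k = 1"
  proof (rule antisym)
    show "onorm k \<le> 1" by (rule onorm_bound) (use k_le in auto)
    show "1 \<le> onorm k" using functionals_bound[OF k, of u] ku nu by simp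
  qed
  then have uk: "(u, k) \<in> polar_pairs sce" using k ku nu by (simp add: polar_pairs_def)
  have "norm (h (J p)) = num_radius sc P"
  proof (rule tendsto_unique[OF H(1)])
    show "((\<lambda>n. norm (f n (P (x n)))) \<longlongrightarrow> num_radius sc P) H"
      by (rule filterlim_mono[OF max order_refl H_seq])
    have "((\<lambda>n. f n p) \<longlongrightarrow> h (J p)) H" using h[rule_format, of "J p"] by (simp add: eve_J \<phi>)
    moreover have "((\<lambda>n. f n (P (x n) - p)) \<longlongrightarrow> 0) H"
    proof (rule Lim_null_comparison)
      show "\<forall>\<^sub>F n in H. norm (f n (P (x n) - p)) \<le> norm (P (x n) - p)"
        using xf'(5) by simp
      have "((\<lambda>n. P (x n)) \<longlongrightarrow> p) H" by (rule filterlim_mono[OF p(1) order_refl H(2)])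
      then show "((\<lambda>n. norm (P (x n) - p)) \<longlongrightarrow> 0) H"
        by (intro tendsto_norm_zero LIM_zero)
    qed
    ultimately have "((\<lambda>n. f n p + f n (P (x n) - p)) \<longlongrightarrow> h (J p) + 0) H" by (rule tendsto_add)
    moreover have "f n p + f n (P (x n) - p) = f n (P (x n))" for n
      using linear_diff[OF bounded_linear.linear[OF functionals_bounded_linear[OF xf'(2)]]] by simp
    ultimately show "((\<lambda>n. norm (f n (P (x n)))) \<longlongrightarrow> norm (h (J p))) H"
      by (intro tendsto_norm) simp
  qed
  then have val: "norm (k (aron_berner sc eve J P u)) = num_radius sc P"
    using hu1 by (simp add: p(2) k_def norm_mult norm_inverse)
  have AB2: "aron_berner sc eve J P \<in> poly2 sce" by (rule aron_berner_poly2[OF poly2_wuD[OF P]])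
  have "num_radius sce (aron_berner sc eve J P) = norm (k (aron_berner sc eve J P u))"
  proof (rule antisym)
    show "num_radius sce (aron_berner sc eve J P) \<le> norm (k (aron_berner sc eve J P u))"
      unfolding val using uk aron_berner_numerical_range_le[OF P ne]
      by (intro D.dual.num_radius_least) auto
    show "norm (k (aron_berner sc eve J P u)) \<le> num_radius sce (aron_berner sc eve J P)"
      by (rule D.dual.num_radius_upper[OF AB2 uk])
  qed
  with AB2 uk show ?thesis unfolding NRA2_def by blast
qed

end


section \<open>Rank-one perturbations\<close>

lemma aligned_phase:
  fixes a :: "'k::real_normed_field"
  assumes "0 \<le> t"
  obtains \<theta> where "norm \<theta> = 1" "norm (a + of_real t * \<theta>) = norm a + t"
proof -
  obtain \<phi> where \<phi>: "norm \<phi> = 1" "\<phi> * a = of_real (norm a)" by (rule norm_one_phase)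
  then have "\<phi> \<noteq> 0" by auto
  have "norm (a + of_real t * inverse \<phi>) = norm (\<phi> * (a + of_real t * inverse \<phi>))"
    by (simp add: norm_mult \<phi>)
  also have "\<phi> * (a + of_real t * inverse \<phi>) = of_real (norm a + t)"
    using \<phi>(2) \<open>\<phi> \<noteq> 0\<close> by (simp add: distrib_left)
  also have "norm (of_real (norm a + t) :: 'k) = norm a + t"
    using assms unfolding norm_of_real by simp
  finally show thesis using that[of "inverse \<phi>"] \<phi>(1) by (simp add: norm_inverse)
qed

context scalar_space
begin

text \<open>
  The phase makes the new term add up in modulus with the value of the functional at the current
  pair, so that this pair alone forces the numerical radius up by nearly \<open>e n\<close>.
\<close>

lemma perturbation_sequence:
  assumes ne: "polar_pairs sc \<noteq> {}" and P0: "P0 \<in> poly2_wu sc" and e: "\<And>n::nat. 0 < (e n :: real)"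
  obtains P x f \<theta> where "P 0 = P0"
    "\<forall>n. P n \<in> poly2_wu sc"
    "\<forall>n. (x n, f n) \<in> polar_pairs sc"
    "\<forall>n. norm (\<theta> n) = 1"
    "\<forall>n. num_radius sc (P n) - e (Suc n) \<le> norm (f n (P n (x n)))"
    "\<forall>n. norm (f n (P n (x n)) + of_real (e n) * \<theta> n) = norm (f n (P n (x n))) + e n"
    "\<forall>n. P (Suc n) = (\<lambda>z. P n z + sc (of_real (e n) * \<theta> n * (f n z)\<^sup>2) (x n))"
proof -
  define A where "A n = (\<lambda>(P, x, f, \<theta>). P \<in> poly2_wu sc \<and> (x, f) \<in> polar_pairs sc \<and> norm \<theta> = 1 \<and>
    num_radius sc P - e (Suc n) \<le> norm (f (P x)) \<and>
    norm (f (P x) + of_real (e n) * \<theta>) = norm (f (P x)) + e n \<and> (n = 0 \<longrightarrow> P = P0))" for n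
  define T where "T n = (\<lambda>(P, x, f, \<theta>) (s :: ('y \<Rightarrow> 'y) \<times> 'y \<times> ('y \<Rightarrow> 'k) \<times> 'k).
    fst s = (\<lambda>z. P z + sc (of_real (e n) * \<theta> * (f z)\<^sup>2) x))" for n
  have choose: "\<exists>s. A n s \<and> fst s = P" if P: "P \<in> poly2_wu sc" "n = 0 \<longrightarrow> P = P0" for n P
  proof -
    have "num_radius sc P - e (Suc n) < num_radius sc P" using e by simp
    then obtain x f where xf: "(x, f) \<in> polar_pairs sc" "num_radius sc P - e (Suc n) < norm (f (P x))"
      by (rule num_radius_near_attained[OF ne])
    obtain \<theta> where "norm \<theta> = 1" "norm (f (P x) + of_real (e n) * \<theta>) = norm (f (P x)) + e n"
      by (rule aligned_phase[OF less_imp_le[OF e]])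
    with P xf show ?thesis by (intro exI[of _ "(P, x, f, \<theta>)"]) (simp add: A_def)
  qed
  have "\<exists>s. \<forall>n. A n (s n) \<and> T n (s n) (s (Suc n))"
  proof (rule dependent_nat_choice)
    show "\<exists>s. A 0 s" using choose[OF P0, of 0] by blast
    fix s n assume s: "A n s"
    obtain P x f \<theta> where s_eq: "s = (P, x, f, \<theta>)" by (cases s)
    have "(\<lambda>z. P z + sc (of_real (e n) * \<theta> * (f z)\<^sup>2) x) \<in> poly2_wu sc"
      using s unfolding s_eq A_def
      by (auto intro!: poly2_wu_add poly2_wu_rank_one dest: polar_pairsD(2))
    from choose[OF this, of "Suc n"] show "\<exists>s'. A (Suc n) s' \<and> T n s s'"
      by (simp add: T_def s_eq)
  qed
  then obtain s where s: "\<And>n. A n (s n)" "\<And>n. T n (s n) (s (Suc n))" by blast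
  define P where "P n = fst (s n)" for n
  define x where "x n = fst (snd (s n))" for n
  define f where "f n = fst (snd (snd (s n)))" for n
  define \<theta> where "\<theta> n = snd (snd (snd (s n)))" for n
  have s_eq: "s n = (P n, x n, f n, \<theta> n)" for n by (simp add: P_def x_def f_def \<theta>_def)
  show thesis
  proof (rule that[of P x f \<theta>])
    show "P 0 = P0" using s(1)[of 0] by (simp add: s_eq A_def)
  qed (use s in \<open>simp_all add: s_eq A_def T_def\<close>)
qed

end

text \<open>
  The weights decrease so fast that all later terms together are small compared with \<open>e n\<close>.  Hence a
  pair \<open>(x m, f m)\<close> with \<open>m > n\<close> can be nearly optimal for \<open>P m\<close> only if it receives nearly the full
  amount \<open>e n\<close> from the \<open>n\<close>-th term, whose contribution to it has modulus
  \<open>e n |f n (x m)|\<^sup>2 |f m (x n)| \<le> e n |f n (x m)|\<close>.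
\<close>

lemma perturbed_limit:
  fixes sc :: "'k::real_normed_field \<Rightarrow> 'y::banach \<Rightarrow> 'y"
  assumes "scalar_space sc" and ne: "polar_pairs sc \<noteq> {}" and P0: "P0 \<in> poly2_wu sc" and a: "0 < a"
  obtains Q x f \<delta> where "Q \<in> poly2_wu sc" "\<forall>z. norm (Q z - P0 z) \<le> a * (norm z)\<^sup>2"
    "\<forall>n. (x n, f n) \<in> polar_pairs sc"
    "(\<lambda>n. norm (f n (Q (x n)))) \<longlonglongrightarrow> num_radius sc Q"
    "\<delta> \<longlonglongrightarrow> 0" "\<forall>m n. n < m \<longrightarrow> 1 - \<delta> n \<le> norm (f n (x m))"
proof -
  interpret scalar_space sc by fact
  \<comment> \<open>The quotient \<open>e (Suc n) / e n\<close> tends to \<open>0\<close>, and the weights add up to at most \<open>2 * e 0 = a\<close>.\<close>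
  define e where "e n = a / 2 / fact (Suc n)" for n :: nat
  have e: "0 < e n" for n using a by (simp add: e_def)
  have e_Suc: "e (Suc n) = e n / (real n + 2)" for n
    by (simp add: e_def field_simps)
  have e_half: "2 * e (Suc n) \<le> e n" for n
    using e[of n] unfolding e_Suc by (simp add: field_simps)
  have e_dec: "e (Suc n) \<le> e n" for n using e_half[of n] e[of "Suc n"] by linarith
  have e_anti: "e m \<le> e n" if "n \<le> m" for m n
    by (rule lift_Suc_antimono_le[of e, OF e_dec that])
  have e_lim: "e \<longlonglongrightarrow> 0"
  proof -
    have "(\<lambda>n. inverse (fact n) :: real) \<longlonglongrightarrow> 0"
      using summable_LIMSEQ_zero[OF summable_exp[of "1::real"]] by simp
    then have "(\<lambda>n. inverse (fact (Suc n)) :: real) \<longlonglongrightarrow> 0" by (rule LIMSEQ_Suc)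
    then have "(\<lambda>n. a / 2 * inverse (fact (Suc n))) \<longlonglongrightarrow> 0"
      by (rule tendsto_mult_right_zero)
    moreover have "e = (\<lambda>n. a / 2 * inverse (fact (Suc n)))"
      by (rule ext) (simp only: e_def divide_inverse)
    ultimately show ?thesis by (simp only:)
  qed
  obtain P x f \<theta> where P_0: "P 0 = P0" and P: "\<forall>n. P n \<in> poly2_wu sc"
    and xf: "\<forall>n. (x n, f n) \<in> polar_pairs sc" and \<theta>: "\<forall>n. norm (\<theta> n) = 1"
    and near: "\<forall>n. num_radius sc (P n) - e (Suc n) \<le> norm (f n (P n (x n)))"
    and aligned: "\<forall>n. norm (f n (P n (x n)) + of_real (e n) * \<theta> n) = norm (f n (P n (x n))) + e n"
    and P_Suc: "\<forall>n. P (Suc n) = (\<lambda>z. P n z + sc (of_real (e n) * \<theta> n * (f n z)\<^sup>2) (x n))"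
    by (rule perturbation_sequence[OF ne P0 e])
  note xf' = polar_pairsD[OF xf[rule_format]]
  define \<nu> where "\<nu> = num_radius sc"
  have P2: "P n \<in> poly2 sc" for n by (rule poly2_wuD[OF P[rule_format]])
  have f_lin: "linear (f n)" for n by (rule bounded_linear.linear[OF functionals_bounded_linear[OF xf'(2)]])
  have step: "norm (P (Suc n) z - P n z) \<le> e n * (norm z)\<^sup>2" for n z
  proof -
    have "norm (P (Suc n) z - P n z) = e n * (norm (f n z))\<^sup>2"
      using e[of n] \<theta> xf'(1) by (simp add: P_Suc norm_sc norm_mult norm_power)
    also have "\<dots> \<le> e n * (norm z)\<^sup>2"
      using e[of n] xf'(5) by (intro mult_left_mono power_mono) auto
    finally show ?thesis .
  qed
  have far: "norm (P m z - P n z) \<le> (2 * e n - 2 * e m) * (norm z)\<^sup>2" if "n \<le> m" for m n z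
    using that
  proof (induction m rule: dec_induct)
    case base
    then show ?case by simp
  next
    case (step m)
    have "norm (P (Suc m) z - P n z) \<le> norm (P (Suc m) z - P m z) + norm (P m z - P n z)"
      using norm_triangle_ineq[of "P (Suc m) z - P m z" "P m z - P n z"] by simp
    also have "\<dots> \<le> e m * (norm z)\<^sup>2 + (2 * e n - 2 * e m) * (norm z)\<^sup>2"
      by (intro add_mono step.IH \<open>\<And>z n. norm (P (Suc n) z - P n z) \<le> e n * (norm z)\<^sup>2\<close>)
    also have "\<dots> = (2 * e n - e m) * (norm z)\<^sup>2" by (simp add: algebra_simps)
    also have "\<dots> \<le> (2 * e n - 2 * e (Suc m)) * (norm z)\<^sup>2"
      using e_half[of m] by (intro mult_right_mono) auto
    finally show ?case .
  qed
  have far': "norm (P m z - P n z) \<le> 2 * e n * (norm z)\<^sup>2" if "n \<le> m" for m n z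
  proof -
    have "(2 * e n - 2 * e m) * (norm z)\<^sup>2 \<le> 2 * e n * (norm z)\<^sup>2"
      using e[of m] by (intro mult_right_mono) auto
    with far[OF that, of z] show ?thesis by simp
  qed
  have "convergent (\<lambda>n. P n z)" for z
  proof (rule Cauchy_convergent, rule metric_CauchyI)
    fix r :: real assume r: "0 < r"
    have "(\<lambda>n. 2 * e n * (norm z)\<^sup>2) \<longlonglongrightarrow> 2 * 0 * (norm z)\<^sup>2"
      by (intro tendsto_intros e_lim)
    then have "\<forall>\<^sub>F n in sequentially. 2 * e n * (norm z)\<^sup>2 < r / 2"
      by (rule order_tendstoD(2)) (use r in simp)
    then obtain N where N: "2 * e N * (norm z)\<^sup>2 < r / 2" by (auto simp: eventually_sequentially)
    have "dist (P m z) (P N z) < r / 2" if "N \<le> m" for m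
      using far'[OF that, of z] N by (simp add: dist_norm)
    then show "\<exists>N. \<forall>m\<ge>N. \<forall>n\<ge>N. dist (P m z) (P n z) < r"
      by (intro exI[of _ N] allI impI) (rule dist_triangle_half_l[of _ "P N z"]; simp add: dist_commute)
  qed
  then have "\<forall>z. \<exists>q. (\<lambda>n. P n z) \<longlonglongrightarrow> q" by (simp add: convergent_def)
  from choice[OF this] obtain Q where Q: "\<forall>z. (\<lambda>n. P n z) \<longlonglongrightarrow> Q z" by blast
  have Q_P: "norm (Q z - P n z) \<le> 2 * e n * (norm z)\<^sup>2" for n z
  proof (rule tendsto_upperbound)
    show "(\<lambda>m. norm (P m z - P n z)) \<longlonglongrightarrow> norm (Q z - P n z)"
      by (intro tendsto_intros Q[rule_format])
    show "\<forall>\<^sub>F m in sequentially. norm (P m z - P n z) \<le> 2 * e n * (norm z)\<^sup>2"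
      using far' by (auto simp: eventually_sequentially)
  qed simp
  have Qwu: "Q \<in> poly2_wu sc"
  proof (rule poly2_wu_limit[OF P[rule_format] Q_P])
    show "(\<lambda>n. 2 * e n) \<longlonglongrightarrow> 0" using tendsto_mult_right_zero[OF e_lim, of 2] by simp
  qed
  note Q2 = poly2_wuD[OF Qwu]
  have f_diff: "norm (f n v) \<le> norm (f n w) + norm (v - w)" for n v w
    using norm_triangle_ineq[of "f n w" "f n (v - w)"] xf'(5)[of n "v - w"] linear_diff[OF f_lin, of n v w]
    by simp
  have gain: "\<nu> (P n) + e n - e (Suc n) \<le> \<nu> (P (Suc n))" for n
  proof -
    have "f n (P (Suc n) (x n)) = f n (P n (x n)) + of_real (e n) * \<theta> n"
      by (simp add: P_Suc linear_add[OF f_lin] functionals_sc[OF xf'(2)] xf'(4))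
    then have "norm (f n (P n (x n))) + e n = norm (f n (P (Suc n) (x n)))"
      using aligned by simp
    also have "\<dots> \<le> \<nu> (P (Suc n))" unfolding \<nu>_def by (rule num_radius_upper[OF P2 xf[rule_format]])
    finally show ?thesis using near[rule_format, of n] by (simp add: \<nu>_def)
  qed
  \<comment> \<open>Each of the six multiples of \<open>e (Suc n) = e n / (real n + 2)\<close> is an error: one for \<open>x n\<close> and one for
    \<open>x m\<close> not being exactly optimal, and two each for comparing \<open>P m\<close> with \<open>P (Suc n)\<close> in value and
    in numerical radius.\<close>
  have "1 - 6 / (real n + 2) \<le> norm (f n (x m))" if nm: "n < m" for m n
  proof -
    define t where "t = norm (f n (x m))"
    have x1: "norm (x m) = 1" by (rule xf'(1))
    have t: "0 \<le> t" "t \<le> 1" using xf'(5)[of n "x m"] x1 by (simp_all add: t_def)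
    have nm': "Suc n \<le> m" using nm by simp
    have "e (Suc m) \<le> e (Suc n)" using nm by (intro e_anti) simp
    have "norm (f m (P (Suc n) (x m))) \<le> \<nu> (P n) + e n * t"
    proof -
      have "f m (P (Suc n) (x m)) = f m (P n (x m)) + of_real (e n) * \<theta> n * (f n (x m))\<^sup>2 * f m (x n)"
        by (simp add: P_Suc linear_add[OF f_lin] functionals_sc[OF xf'(2)])
      then have "norm (f m (P (Suc n) (x m))) \<le> norm (f m (P n (x m))) + e n * (t\<^sup>2 * norm (f m (x n)))"
        using norm_triangle_ineq[of "f m (P n (x m))" "of_real (e n) * \<theta> n * (f n (x m))\<^sup>2 * f m (x n)"] e[of n] \<theta>
        by (simp add: norm_mult norm_power t_def mult.assoc)
      moreover have "norm (f m (P n (x m))) \<le> \<nu> (P n)"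
        unfolding \<nu>_def by (rule num_radius_upper[OF P2 xf[rule_format]])
      moreover have "t\<^sup>2 * norm (f m (x n)) \<le> t * 1"
      proof (rule mult_mono)
        show "t\<^sup>2 \<le> t" using t by (simp add: power2_eq_square mult_left_le)
        show "norm (f m (x n)) \<le> 1" using xf'(5)[of m "x n"] xf'(1)[of n] by simp
      qed (use t in auto)
      then have "e n * (t\<^sup>2 * norm (f m (x n))) \<le> e n * t" using e[of n] by simp
      ultimately show ?thesis by linarith
    qed
    moreover have "norm (f m (P m (x m))) \<le> norm (f m (P (Suc n) (x m))) + 2 * e (Suc n)"
      using f_diff[of m "P m (x m)" "P (Suc n) (x m)"] far'[OF nm', of "x m"] x1 by simp
    moreover have "\<nu> (P (Suc n)) \<le> \<nu> (P m) + 2 * e (Suc n)"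
      unfolding \<nu>_def
    proof (rule num_radius_perturb[OF ne P2])
      show "norm (P (Suc n) z - P m z) \<le> 2 * e (Suc n)" if "norm z = 1" for z
        using far'[OF nm', of z] that by (simp add: norm_minus_commute)
    qed
    ultimately have "e n - 6 * e (Suc n) \<le> e n * t"
      using near[rule_format, of m] gain[of n] \<open>e (Suc m) \<le> e (Suc n)\<close> by (simp add: \<nu>_def)
    moreover have "e n - 6 * e (Suc n) = e n * (1 - 6 / (real n + 2))" by (simp add: e_Suc algebra_simps)
    ultimately have "e n * (1 - 6 / (real n + 2)) \<le> e n * t" by simp
    then show ?thesis using e[of n] by (simp add: t_def)
  qed
  moreover have "(\<lambda>n. norm (f n (Q (x n)))) \<longlonglongrightarrow> num_radius sc Q"
  proof (rule tendsto_sandwich[OF always_eventually always_eventually _ tendsto_const])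
    show "\<forall>n. num_radius sc Q - 5 * e n \<le> norm (f n (Q (x n)))"
    proof
      fix n
      have "norm (f n (P n (x n))) \<le> norm (f n (Q (x n))) + 2 * e n"
        using f_diff[of n "P n (x n)" "Q (x n)"] Q_P[of "x n" n] xf'(1)[of n] by (simp add: norm_minus_commute)
      moreover have "num_radius sc Q \<le> num_radius sc (P n) + 2 * e n"
      proof (rule num_radius_perturb[OF ne P2])
        show "norm (Q z - P n z) \<le> 2 * e n" if "norm z = 1" for z using Q_P[of z n] that by simp
      qed
      ultimately show "num_radius sc Q - 5 * e n \<le> norm (f n (Q (x n)))"
        using near[rule_format, of n] e_anti[of n "Suc n"] by simp
    qed
    show "\<forall>n. norm (f n (Q (x n))) \<le> num_radius sc Q"
      using num_radius_upper[OF Q2] xf by blast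
    have "(\<lambda>n. num_radius sc Q - 5 * e n) \<longlonglongrightarrow> num_radius sc Q - 5 * 0" by (intro tendsto_intros e_lim)
    then show "(\<lambda>n. num_radius sc Q - 5 * e n) \<longlonglongrightarrow> num_radius sc Q" by simp
  qed
  moreover have "(\<lambda>n. 6 / (real n + 2)) \<longlonglongrightarrow> 0" using LIMSEQ_ignore_initial_segment[OF lim_const_over_n[of "6::real"], of 2] by (simp add: add.commute)
  moreover have "\<forall>z. norm (Q z - P0 z) \<le> a * (norm z)\<^sup>2" using Q_P[of _ 0] by (simp add: P_0 e_def)
  ultimately show thesis
    using Qwu xf by (intro that[of Q x f "\<lambda>n. 6 / (real n + 2)"]) auto
qed


section \<open>Density\<close>

context bidual_space
begin

lemma aron_berner_numerical_radius_attaining_dense: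
  assumes "\<exists>x::'x. x \<noteq> 0"
  shows "poly_dense {P \<in> poly2_wu sc. aron_berner sc eve J P \<in> NRA2 sce} (poly2_wu sc)"
  unfolding poly_dense_def
proof (intro conjI ballI allI impI)
  fix P :: "'x \<Rightarrow> 'x" and \<epsilon> :: real assume P: "P \<in> poly2_wu sc" and \<epsilon>: "0 < \<epsilon>"
  have ne: "polar_pairs sc \<noteq> {}" using assms norming_polar_pair by blast
  obtain Q x f \<delta> where Q: "Q \<in> poly2_wu sc" "\<forall>z. norm (Q z - P z) \<le> (\<epsilon> / 2) * (norm z)\<^sup>2"
    and seq: "\<forall>n. (x n, f n) \<in> polar_pairs sc"
    "(\<lambda>n. norm (f n (Q (x n)))) \<longlonglongrightarrow> num_radius sc Q"
    "\<delta> \<longlonglongrightarrow> 0" "\<forall>m n. n < m \<longrightarrow> 1 - \<delta> n \<le> norm (f n (x m))"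
    by (rule perturbed_limit[OF scalar_space_axioms ne P half_gt_zero[OF \<epsilon>]])
  have "aron_berner sc eve J Q \<in> NRA2 sce"
    by (rule aron_berner_attains[OF Q(1) seq(1)[rule_format] seq(2,3) seq(4)[rule_format]])
  moreover have "poly_norm (\<lambda>z. P z - Q z) \<le> \<epsilon> / 2"
    unfolding poly_norm_def
  proof (rule cSUP_least)
    show "{y::'x. norm y \<le> 1} \<noteq> {}" by (auto intro: exI[of _ 0])
    fix z :: 'x assume "z \<in> {y. norm y \<le> 1}"
    then have "(\<epsilon> / 2) * (norm z)\<^sup>2 \<le> (\<epsilon> / 2) * 1"
      using \<epsilon> by (intro mult_left_mono power_le_one) auto
    with Q(2) show "norm (P z - Q z) \<le> \<epsilon> / 2" by (metis mult_1_right norm_minus_commute order_trans)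
  qed
  then have "poly_norm (\<lambda>z. P z - Q z) < \<epsilon>" using \<epsilon> by simp
  ultimately show "\<exists>Q\<in>{P \<in> poly2_wu sc. aron_berner sc eve J P \<in> NRA2 sce}. poly_norm (\<lambda>z. P z - Q z) < \<epsilon>"
    using Q(1) by blast
qed auto

end


section \<open>Real and complex Banach spaces\<close>

lemma scalar_space_scaleR: "scalar_space ((*\<^sub>R) :: real \<Rightarrow> 'y::real_normed_vector \<Rightarrow> 'y)"
  by standard (simp_all add: algebra_simps)

lemma scalar_space_scaleC: "scalar_space ((*\<^sub>C) :: complex \<Rightarrow> 'y::complex_normed_vector \<Rightarrow> 'y)"
  by standard (simp_all add: scaleC_add_right scaleC_add_left scaleC_scaleC scaleC_of_real norm_scaleC)

lemma scalar_conjugation_real: "scalar_conjugation (\<lambda>x::real. x)"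
  by standard simp_all

lemma scalar_conjugation_complex: "scalar_conjugation cnj"
  by standard (simp_all add: inner_complex_def)

lemma dual_space_real:
  "dual_space (*\<^sub>R) (*\<^sub>R) (blinfun_apply :: 'a::real_normed_vector rdual \<Rightarrow> 'a \<Rightarrow> real)"
proof (intro dual_space.intro scalar_space_scaleR dual_space_axioms.intro)
  show "range (blinfun_apply :: 'a rdual \<Rightarrow> 'a \<Rightarrow> real) = functionals (*\<^sub>R)"
  proof (intro equalityI subsetI)
    fix f :: "'a \<Rightarrow> real" assume "f \<in> functionals (*\<^sub>R)"
    then have "f = blinfun_apply (Blinfun f)"
      by (simp add: functionals_def bounded_linear_Blinfun_apply)
    then show "f \<in> range blinfun_apply" by (rule range_eqI)
  next
    fix f :: "'a \<Rightarrow> real" assume "f \<in> range blinfun_apply"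
    then show "f \<in> functionals (*\<^sub>R)"
      by (auto simp: functionals_def blinfun.bounded_linear_right blinfun.scaleR_right)
  qed
qed (simp_all add: norm_blinfun.rep_eq blinfun.add_left blinfun.scaleR_left)

lemma dual_space_complex:
  "dual_space (*\<^sub>C) (*\<^sub>C) (cdual_apply :: 'a::complex_normed_vector cdual \<Rightarrow> 'a \<Rightarrow> complex)"
proof (intro dual_space.intro scalar_space_scaleC dual_space_axioms.intro)
  show "range (cdual_apply :: 'a cdual \<Rightarrow> 'a \<Rightarrow> complex) = functionals (*\<^sub>C)"
    by (rule type_definition.Rep_range[OF type_definition_cdual])
qed (simp_all add: norm_cdual.rep_eq plus_cdual.rep_eq scaleC_cdual.rep_eq)

interpretation real_bidual:
  bidual_space "\<lambda>x::real. x" "(*\<^sub>R) :: real \<Rightarrow> 'a::banach \<Rightarrow> 'a" "(*\<^sub>R)" blinfun_apply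
    "(*\<^sub>R)" blinfun_apply "blinfun.prod_left"
  by (intro bidual_space.intro conjugation_space.intro scalar_conjugation_real scalar_space_scaleR
      dual_space_real bidual_space_axioms.intro rdual_embedding_apply)

interpretation complex_bidual:
  bidual_space cnj "(*\<^sub>C) :: complex \<Rightarrow> 'a::complex_banach \<Rightarrow> 'a" "(*\<^sub>C)" cdual_apply
    "(*\<^sub>C)" cdual_apply cdual_embedding
  by (intro bidual_space.intro conjugation_space.intro scalar_conjugation_complex scalar_space_scaleC
      dual_space_complex bidual_space_axioms.intro) (simp add: cdual_embedding.rep_eq)

theorem theorem4p2:
  shows
    "((\<exists>x :: 'a::banach. x \<noteq> 0) \<longrightarrow>
        poly_dense
          {P \<in> poly2_wu ((*\<^sub>R) :: real \<Rightarrow> 'a \<Rightarrow> 'a).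
             AB_real P \<in> NRA2 ((*\<^sub>R) :: real \<Rightarrow> 'a rdual rdual \<Rightarrow> 'a rdual rdual)}
          (poly2_wu ((*\<^sub>R) :: real \<Rightarrow> 'a \<Rightarrow> 'a))) \<and>
     ((\<exists>x :: 'b::complex_banach. x \<noteq> 0) \<longrightarrow>
        poly_dense
          {P \<in> poly2_wu ((*\<^sub>C) :: complex \<Rightarrow> 'b \<Rightarrow> 'b).
             AB_complex P \<in> NRA2 ((*\<^sub>C) :: complex \<Rightarrow> 'b cdual cdual \<Rightarrow> 'b cdual cdual)}
          (poly2_wu ((*\<^sub>C) :: complex \<Rightarrow> 'b \<Rightarrow> 'b)))"
  unfolding AB_real_def AB_complex_def
  using real_bidual.aron_berner_numerical_radius_attaining_dense
    complex_bidual.aron_berner_numerical_radius_attaining_dense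
  by blast

end
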